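(* Consider the problem $\min_{x\in X}P(x)$ with $P(x)=\max_{y\in Y}f(x,y)$ described in the context. Let $0<\epsilon<\epsilon_0$ and assume that: (1) $x_0\in X$ satisfies $P(x_0)-P^*\le\epsilon_0$; (2) the stochastic subgradients satisfy $\|\nabla_x f(x,y;\xi)\|\le M$ and $\|\nabla_y f(x,y;\xi)\|\le B$ for all $x\in X$, $y\in Y$ and all $\xi$; (3) $\phi^*$ is $p$-uniformly convex ($p\ge2$) with constant $\lambda_\phi>0$, so that $\phi$ is differentiable with $(L,v)$-Hölder continuous gradient, where $v=\frac1{p-1}$ and $L=(1/\lambda_\phi)^v$; (4) $\ell$ is $G$-Lipschitz continuous on $X$; (5) $P$ satisfies the local error bound condition $\mathrm{dist}(x,X^* )\le c\,(P(x)-P^* )^\theta$ for all $x\in\mathcal S_\epsilon$, with $c>0$ and $\theta\in(0,1]$. Given $\delta\in(0,1)$, let $S=\lceil\log_2(\epsilon_0/\epsilon)\rceil$, $\tilde\delta=\delta/S$, let $R_{x,1}\ge\frac{c\epsilon_0}{\epsilon^{1-\theta}}$ with $R_{x,1}=O\!\left(\frac{c\epsilon_0}{\epsilon^{1-\theta}}\right)$, put $\epsilon_s=\epsilon_0/2^s$ and $R_{x,s}=R_{x,1}/2^{s-1}$, and let $T$ be an integer such that for all $s=1,\dots,S$ $$T\ge\max\left\{\frac{320M^2R_{x,s}^2}{\epsilon_{s-1}^2},\ \frac{320B^2L^2G^{2v}R_{x,s}^{2v}}{\epsilon_{s-1}^2},\ \frac{8192\log(1/\tilde\delta)M^2R_{x,s}^2}{\epsilon_{s-1}^2},\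 \frac{8192\log(1/\tilde\delta)B^2L^2G^{2v}R_{x,s}^{2v}}{\epsilon_{s-1}^2}\right\}.$$ Then the output $\bar x_S$ of the algorithm RSPD$(x_0,S,T,R_{x,1},\epsilon_0)$ described in the context satisfies $P(\bar x_S)-P^*\le2\epsilon$ with probability at least $1-\delta$. With $T$ taken of the order of $$\max_{1\le s\le S}\max\left\{\frac{320M^2R_{x,s}^2}{\epsilon_{s-1}^2},\ \frac{320B^2L^2G^{2v}R_{x,s}^{2v}}{\epsilon_{s-1}^2},\ \frac{8192\log(1/\tilde\delta)M^2R_{x,s}^2}{\epsilon_{s-1}^2},\ \frac{8192\log(1/\tilde\delta)B^2L^2G^{2v}R_{x,s}^{2v}}{\epsilon_{s-1}^2}\right\},$$ the total number of iterations $ST$ is $\widetilde O\!\left(\frac{1}{\epsilon^{2(1-v\theta)}}\right)$, where $\widetilde O$ suppresses a logarithmic factor.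
   Context: Setting. $X\subseteq\mathbb{R}^d$ is a closed convex set; $\ell=(\ell_1,\dots,\ell_n)^\top:X\to\mathbb{R}^n$ has lower-semicontinuous convex components; $g:X\to\mathbb{R}$ is lower-semicontinuous and convex; $\phi^*$ is a convex function with domain $Y=\mathrm{dom}(\phi^* )\subseteq\mathbb{R}^n$ (closed, so that projections onto it are defined), and $\phi^*$ and $\phi$ are convex conjugates of each other. If $\ell$ is not affine, $Y\subseteq\mathbb{R}^n_+$. Put $$f(x,y)=y^\top\ell(x)-\phi^*(y)+g(x),\qquad P(x)=\phi(\ell(x))+g(x)=\max_{y\in Y}f(x,y).$$ $P^*$ is the minimum of $P$ over $X$, attained on the nonempty set $X^*$. $\|\cdot\|$ is the Euclidean norm, $\mathrm{dist}(x,X^* )=\min_{z\in X^*}\|x-z\|$, $\Pi_\Omega$ is Euclidean projection onto $\Omega$, and $\mathcal S_\epsilon=\{x\in X:P(x)-P^*\le\epsilon\}$. Definitions. $h$ is $p$-uniformly convex with constant $\lambda>0$ if $h(x_1)\ge h(x_2)+\partial h(x_2)^\top(x_1-x_2)+\frac{\lambda}{2}\|x_1-x_2\|^p$ for all $x_1,x_2$ and any subgradient $\partial h(x_2)$. A differentiable $h$ has $(L,v)$-Hölder continuous gradient if $\|\nabla h(x_1)-\nabla h(x_2)\|\le L\|x_1-x_2\|^v$ for all $x_1,x_2$. Stochastic subgradients. $\nabla_x f(x,y;\xi)$ and $\nabla_y f(x,y;\xi)$ are stochastic subgradients of $f$ with respect to $x$ and $y$: their expectations over $\xi$ are, respectively,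 a subgradient of $f(\cdot,y)$ at $x$ and a supergradient of $f(x,\cdot)$ at $y$. The samples $\xi_t^s$ used by the algorithm are drawn independently of the past. $M,B>0$. Dual map. $\mathcal A(x)=\arg\max_{y\in Y}\{y^\top\ell(x)-\phi^*(y)\}$. Balls: $\mathcal B_x(x_0,R)=\{x\in X:\|x-x_0\|\le R\}$, $\mathcal B_y(y_0,R)=\{y\in Y:\|y-y_0\|\le R\}$. Algorithm RSPD$(x_0,S,T,R_{x,1},\epsilon_0)$. Initialize $x_0^{(1)}=x_0$, $y_0^{(1)}=\mathcal A(x_0^{(1)})$, $R_{y,1}=LG^vR_{x,1}^v$, $\eta_{x,1}=\frac{\epsilon_0}{40M^2}$, $\eta_{y,1}=\frac{\epsilon_0}{40B^2}$. For $s=1,\dots,S$: for $t=0,\dots,T-1$ set $$x_{t+1}^{(s)}=\Pi_{\mathcal B_x(x_0^{(s)},R_{x,s})}\big(x_t^{(s)}-\eta_{x,s}\nabla_xf(x_t^{(s)},y_t^{(s)};\xi_t^s)\big),\quad y_{t+1}^{(s)}=\Pi_{\mathcal B_y(y_0^{(s)},R_{y,s})}\big(y_t^{(s)}+\eta_{y,s}\nabla_yf(x_t^{(s)},y_t^{(s)};\xi_t^s)\big);$$ then set $x_0^{(s+1)}=\bar x_s=\frac1T\sum_{t=0}^{T-1}x_t^{(s)}$, $y_0^{(s+1)}=\mathcal A(x_0^{(s+1)})$, $R_{x,s+1}=R_{x,s}/2$, $R_{y,s+1}=R_{y,s}/2^v$, $\eta_{x,s+1}=\eta_{x,s}/2$,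 $\eta_{y,s+1}=\eta_{y,s}/2$. Output $\bar x_S$. In the $\widetilde O(\cdot)$ bound the dependence on $M,B,L,G,c,\epsilon_0$ is suppressed, and so are factors logarithmic in $1/\epsilon$ and $S/\delta$. *)

theory Defs
  imports "HOL-Probability.Probability"
begin

definition lsc_on :: "'a::topological_space set \<Rightarrow> ('a \<Rightarrow> real) \<Rightarrow> bool" where
  "lsc_on S h \<longleftrightarrow> (\<forall>x\<in>S. \<forall>a < h x. \<forall>\<^sub>F z in at x within S. a < h z)"

text \<open>A convex function with effective domain \<open>S\<close> is represented by \<open>S\<close> and its finite values
  on \<open>S\<close>; \<open>extend_infty\<close> turns this into the extended-real-valued function.\<close>

definition extend_infty :: "'a set \<Rightarrow> ('a \<Rightarrow> real) \<Rightarrow> 'a \<Rightarrow> ereal" where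
  "extend_infty S h x = (if x \<in> S then ereal (h x) else \<infinity>)"

definition convex_conjugate :: "('a::real_inner \<Rightarrow> ereal) \<Rightarrow> 'a \<Rightarrow> ereal" where
  "convex_conjugate h u = (SUP y. ereal (y \<bullet> u) - h y)"

definition subgradient_on :: "'a::real_inner set \<Rightarrow> ('a \<Rightarrow> real) \<Rightarrow> 'a \<Rightarrow> 'a \<Rightarrow> bool" where
  "subgradient_on S h x d \<longleftrightarrow> x \<in> S \<and> (\<forall>z\<in>S. h z \<ge> h x + d \<bullet> (z - x))"

definition supergradient_on :: "'a::real_inner set \<Rightarrow> ('a \<Rightarrow> real) \<Rightarrow> 'a \<Rightarrow> 'a \<Rightarrow> bool" where
  "supergradient_on S h x d \<longleftrightarrow> x \<in> S \<and> (\<forall>z\<in>S. h z \<le> h x + d \<bullet> (z - x))"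

definition uniformly_convex_on ::
    "'a::real_inner set \<Rightarrow> real \<Rightarrow> real \<Rightarrow> ('a \<Rightarrow> real) \<Rightarrow> bool" where
  "uniformly_convex_on S p lam h \<longleftrightarrow>
     (\<forall>x1\<in>S. \<forall>x2\<in>S. \<forall>d. subgradient_on S h x2 d \<longrightarrow>
        h x1 \<ge> h x2 + d \<bullet> (x1 - x2) + lam / 2 * norm (x1 - x2) powr p)"

definition holder_gradient :: "real \<Rightarrow> real \<Rightarrow> ('a::real_inner \<Rightarrow> real) \<Rightarrow> bool" where
  "holder_gradient L v h \<longleftrightarrow>
     (\<exists>h'. (\<forall>x. GDERIV h x :> h' x) \<and>
           (\<forall>x1 x2. norm (h' x1 - h' x2) \<le> L * norm (x1 - x2) powr v))"

definition saddle_obj ::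
    "('a \<Rightarrow> 'b::real_inner) \<Rightarrow> ('b \<Rightarrow> real) \<Rightarrow> ('a \<Rightarrow> real) \<Rightarrow> 'a \<Rightarrow> 'b \<Rightarrow> real" where
  "saddle_obj l phis g x y = y \<bullet> l x - phis y + g x"

definition primal_obj :: "('a \<Rightarrow> 'b) \<Rightarrow> ('b \<Rightarrow> real) \<Rightarrow> ('a \<Rightarrow> real) \<Rightarrow> 'a \<Rightarrow> real" where
  "primal_obj l phi g x = phi (l x) + g x"

definition min_value :: "'a set \<Rightarrow> ('a \<Rightarrow> real) \<Rightarrow> real" where
  "min_value X P = (INF x\<in>X. P x)"

definition minimizers :: "'a set \<Rightarrow> ('a \<Rightarrow> real) \<Rightarrow> 'a set" where
  "minimizers X P = {x. is_arg_min P (\<lambda>z. z \<in> X) x}"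

definition opt_sublevel :: "'a set \<Rightarrow> ('a \<Rightarrow> real) \<Rightarrow> real \<Rightarrow> 'a set" where
  "opt_sublevel X P eps = {x\<in>X. P x - min_value X P \<le> eps}"

definition dual_map ::
    "('a \<Rightarrow> 'b::real_inner) \<Rightarrow> ('b \<Rightarrow> real) \<Rightarrow> 'b set \<Rightarrow> 'a \<Rightarrow> 'b" where
  "dual_map l phis Y x = arg_max (\<lambda>y. y \<bullet> l x - phis y) (\<lambda>y. y \<in> Y)"

text \<open>The pair of iterates after \<open>t\<close> steps of one stage; \<open>gx\<close>, \<open>gy\<close> are the stochastic gradient
  oracles and \<open>z t\<close> is the sample used in step \<open>t\<close>.\<close>

primrec stage_iterates ::
    "'a::euclidean_space set \<Rightarrow> 'b::euclidean_space set \<Rightarrow>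
     ('a \<Rightarrow> 'b \<Rightarrow> 'z \<Rightarrow> 'a) \<Rightarrow> ('a \<Rightarrow> 'b \<Rightarrow> 'z \<Rightarrow> 'b) \<Rightarrow>
     'a \<Rightarrow> 'b \<Rightarrow> real \<Rightarrow> real \<Rightarrow> real \<Rightarrow> real \<Rightarrow> (nat \<Rightarrow> 'z) \<Rightarrow> nat \<Rightarrow> 'a \<times> 'b" where
  "stage_iterates X Y gx gy x0 y0 Rx Ry etax etay z 0 = (x0, y0)"
| "stage_iterates X Y gx gy x0 y0 Rx Ry etax etay z (Suc t) =
     (case stage_iterates X Y gx gy x0 y0 Rx Ry etax etay z t of (x, y) \<Rightarrow>
        (closest_point {x'\<in>X. norm (x' - x0) \<le> Rx} (x - etax *\<^sub>R gx x y (z t)),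
         closest_point {y'\<in>Y. norm (y' - y0) \<le> Ry} (y + etay *\<^sub>R gy x y (z t))))"

text \<open>The value at \<open>s\<close> is the tuple of start point, radii and step sizes with which stage
  \<open>s + 1\<close> is entered. Its first component is therefore the average \<open>x\<close>-iterate of stage \<open>s\<close>
  (for \<open>s > 0\<close>). The samples of stage \<open>s\<close> are \<open>z s\<close>, with stages counted from 1.\<close>

primrec rspd_state ::
    "'a::euclidean_space set \<Rightarrow> 'b::euclidean_space set \<Rightarrow>
     ('a \<Rightarrow> 'b \<Rightarrow> 'z \<Rightarrow> 'a) \<Rightarrow> ('a \<Rightarrow> 'b \<Rightarrow> 'z \<Rightarrow> 'b) \<Rightarrow> ('a \<Rightarrow> 'b) \<Rightarrow>
     real \<Rightarrow> real \<Rightarrow> real \<Rightarrow> real \<Rightarrow> real \<Rightarrow>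
     'a \<Rightarrow> nat \<Rightarrow> real \<Rightarrow> real \<Rightarrow> (nat \<Rightarrow> nat \<Rightarrow> 'z) \<Rightarrow> nat \<Rightarrow>
     'a \<times> real \<times> real \<times> real \<times> real" where
  "rspd_state X Y gx gy A M B L G v x0 T Rx1 eps0 z 0 =
     (x0, Rx1, L * G powr v * Rx1 powr v, eps0 / (40 * M\<^sup>2), eps0 / (40 * B\<^sup>2))"
| "rspd_state X Y gx gy A M B L G v x0 T Rx1 eps0 z (Suc s) =
     (case rspd_state X Y gx gy A M B L G v x0 T Rx1 eps0 z s of (x, Rx, Ry, etax, etay) \<Rightarrow>
        ((1 / real T) *\<^sub>R
           (\<Sum>t<T. fst (stage_iterates X Y gx gy x (A x) Rx Ry etax etay (z (Suc s)) t)),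
         Rx / 2, Ry / 2 powr v, etax / 2, etay / 2))"

definition rspd ::
    "'a::euclidean_space set \<Rightarrow> 'b::euclidean_space set \<Rightarrow>
     ('a \<Rightarrow> 'b \<Rightarrow> 'z \<Rightarrow> 'a) \<Rightarrow> ('a \<Rightarrow> 'b \<Rightarrow> 'z \<Rightarrow> 'b) \<Rightarrow> ('a \<Rightarrow> 'b) \<Rightarrow>
     real \<Rightarrow> real \<Rightarrow> real \<Rightarrow> real \<Rightarrow> real \<Rightarrow>
     'a \<Rightarrow> nat \<Rightarrow> nat \<Rightarrow> real \<Rightarrow> real \<Rightarrow> (nat \<Rightarrow> nat \<Rightarrow> 'z) \<Rightarrow> 'a" where
  "rspd X Y gx gy A M B L G v x0 S T Rx1 eps0 z =
     fst (rspd_state X Y gx gy A M B L G v x0 T Rx1 eps0 z S)"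

definition num_stages :: "real \<Rightarrow> real \<Rightarrow> nat" where
  "num_stages eps0 eps = nat \<lceil>log 2 (eps0 / eps)\<rceil>"

text \<open>The iteration requirement of stage \<open>s\<close>, with \<open>R\<close> = \<open>R\<^sub>x\<^sub>,\<^sub>s\<close>, \<open>e\<close> = \<open>\<epsilon>\<^sub>s\<^sub>-\<^sub>1\<close>
  and \<open>dt\<close> the failure probability \<open>\<delta> / S\<close> allotted to each stage.\<close>

definition stage_requirement ::
    "real \<Rightarrow> real \<Rightarrow> real \<Rightarrow> real \<Rightarrow> real \<Rightarrow> real \<Rightarrow> real \<Rightarrow> real \<Rightarrow> nat \<Rightarrow> real" where
  "stage_requirement M B L G v eps0 Rx1 dt s =
     (let R = Rx1 / 2 ^ (s - 1); e = eps0 / 2 ^ (s - 1) in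
      Max {320 * M\<^sup>2 * R\<^sup>2 / e\<^sup>2,
           320 * B\<^sup>2 * L\<^sup>2 * G powr (2 * v) * R powr (2 * v) / e\<^sup>2,
           8192 * ln (1 / dt) * M\<^sup>2 * R\<^sup>2 / e\<^sup>2,
           8192 * ln (1 / dt) * B\<^sup>2 * L\<^sup>2 * G powr (2 * v) * R powr (2 * v) / e\<^sup>2})"

end

theory Submission
  imports Defs
begin

text \<open>Uniform convexity of \<open>phis\<close> makes the maximiser \<open>A x\<close> unique and Hoelder continuous in \<open>x\<close>; hence the
  dual ball of a stage contains \<open>A\<close> of every point of the primal ball. Projected subgradient descent-ascent
  then bounds the primal gap of the averaged iterate by deterministic regret terms plus a martingale,
  which is controlled by Azuma's inequality. The comparison point of a stage is the projection \<open>z\<close> of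
  its start point onto the \<open>eps\<close>-sublevel set: by convexity and the error bound, \<open>z\<close> lies in the primal
  ball. So, outside an event of probability \<open>\<delta> / S\<close>, a stage halves the gap above level \<open>eps\<close>. Conditioning on the
  past is expressed by a potential function of the state that does not increase in expectation.\<close>

subsection \<open>Projections\<close>

text \<open>The dual comparison point \<open>A (xbar \<omega>)\<close> depends on every sample of
  the stage, so the dual noise tested against it is no martingale. A further projected sequence, run
  on the noise alone, absorbs this dependence: its regret bound holds for each outcome and for every
  comparison point. The primal comparison point raises no such concern across stages, because each
  stage is analysed from a fixed start point and the comparison point is chosen for that start point
  without any measurable selection. What must be measurable is the stage as a function of start
  point and samples; since its balls are centred at a random start, projections have to be jointly
  continuous in the centre and the projected point. The error bound is available only on the
  \<open>eps\<close>-sublevel set, which is why the comparison point is taken there and not among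
  the minimisers. Halving then acts on the excess over \<open>eps\<close>, radius and excess shrink
  by the same factor 2, and the last stage ends at \<open>2 * eps\<close>.\<close>

lemma closest_point_step:
  fixes C :: "'a::euclidean_space set"
  assumes "convex C" "closed C" "q \<in> C"
  shows "2 * (u \<bullet> (w - q)) \<le> (norm (w - q))\<^sup>2 - (norm (closest_point C (w - u) - q))\<^sup>2 + (norm u)\<^sup>2"
proof -
  let ?r = "closest_point C (w - u)"
  have "(w - u - ?r) \<bullet> (q - ?r) \<le> 0"
    by (rule closest_point_dot[OF assms])
  moreover have "(norm (w - q))\<^sup>2 - (norm (?r - q))\<^sup>2 + (norm u)\<^sup>2 - 2 * (u \<bullet> (w - q))
      = (norm (w - u - ?r))\<^sup>2 - 2 * ((w - u - ?r) \<bullet> (q - ?r))"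
    by (simp add: power2_norm_eq_inner inner_diff_left inner_diff_right inner_commute algebra_simps)
  ultimately show ?thesis
    using zero_le_power2[of "norm (w - u - ?r)"] by linarith
qed

text \<open>No convex function is involved: the directions \<open>u t\<close> are arbitrary bounded
  vectors. Hence one bound serves primal descent, dual ascent with negated directions, and the ghost
  iterate driven by pure noise, and \<open>q\<close> may depend on all directions. The proof
  telescopes \<open>closest_point_step\<close>.\<close>

lemma projected_subgradient_regret:
  fixes C :: "'a::euclidean_space set"
  assumes C: "convex C" "closed C" "q \<in> C" and eta: "0 < eta"
    and step: "\<And>t. t < n \<Longrightarrow> w (Suc t) = closest_point C (w t - eta *\<^sub>R u t)"
    and u: "\<And>t. t < n \<Longrightarrow> norm (u t) \<le> K"
    and w0: "norm (w 0 - q) \<le> R"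
  shows "(\<Sum>t<n. u t \<bullet> (w t - q)) \<le> R\<^sup>2 / (2 * eta) + eta * K\<^sup>2 / 2 * real n"
proof -
  have one: "u t \<bullet> (w t - q) \<le> ((norm (w t - q))\<^sup>2 - (norm (w (Suc t) - q))\<^sup>2) / (2 * eta) + eta * K\<^sup>2 / 2"
    if "t < n" for t
  proof -
    have "2 * (eta *\<^sub>R u t \<bullet> (w t - q)) \<le> (norm (w t - q))\<^sup>2 - (norm (w (Suc t) - q))\<^sup>2 + (norm (eta *\<^sub>R u t))\<^sup>2"
      unfolding step[OF that] by (rule closest_point_step[OF C])
    moreover have "(norm (eta *\<^sub>R u t))\<^sup>2 \<le> (eta * K)\<^sup>2"
      using u[OF that] eta by (intro power_mono) auto
    ultimately have "2 * eta * (u t \<bullet> (w t - q)) \<le> (norm (w t - q))\<^sup>2 - (norm (w (Suc t) - q))\<^sup>2 + (eta * K)\<^sup>2"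
      by simp
    then show ?thesis
      using eta by (simp add: field_simps power2_eq_square)
  qed
  have "(\<Sum>t<n. u t \<bullet> (w t - q))
      \<le> (\<Sum>t<n. ((norm (w t - q))\<^sup>2 - (norm (w (Suc t) - q))\<^sup>2) / (2 * eta) + eta * K\<^sup>2 / 2)"
    using one by (intro sum_mono) auto
  also have "\<dots> = ((norm (w 0 - q))\<^sup>2 - (norm (w n - q))\<^sup>2) / (2 * eta) + eta * K\<^sup>2 / 2 * real n"
    unfolding sum.distrib sum_divide_distrib[symmetric] sum_lessThan_telescope'[of "\<lambda>t. (norm (w t - q))\<^sup>2" n]
    by simp
  also have "\<dots> \<le> R\<^sup>2 / (2 * eta) + eta * K\<^sup>2 / 2 * real n"
  proof -
    have "(norm (w 0 - q))\<^sup>2 \<le> R\<^sup>2"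
      using w0 by (simp add: power_mono)
    then have "(norm (w 0 - q))\<^sup>2 - (norm (w n - q))\<^sup>2 \<le> R\<^sup>2"
      using zero_le_power2[of "norm (w n - q)"] by linarith
    then show ?thesis
      using eta by (simp add: divide_right_mono)
  qed
  finally show ?thesis .
qed

lemma convex_ball_slice: "convex X \<Longrightarrow> convex {x'\<in>X. norm (x' - a) \<le> R}"
  for X :: "'a::real_normed_vector set"
proof -
  assume "convex X"
  moreover have "{x'\<in>X. norm (x' - a) \<le> R} = X \<inter> cball a R"
    by (auto simp: dist_norm norm_minus_commute)
  ultimately show ?thesis by (simp add: convex_Int)
qed

lemma closed_ball_slice: "closed X \<Longrightarrow> closed {x'\<in>X. norm (x' - a) \<le> R}"
  for X :: "'a::real_normed_vector set"
proof -
  assume "closed X"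
  moreover have "{x'\<in>X. norm (x' - a) \<le> R} = X \<inter> cball a R"
    by (auto simp: dist_norm norm_minus_commute)
  ultimately show ?thesis by (simp add: closed_Int)
qed

text \<open>The Hausdorff distance of two slices of equal radius is at most the distance
  \<open>d\<close> of their centres. Pulling \<open>u\<close> towards \<open>b\<close> by the factor
  \<open>R / (R + d)\<close> brings it into the new ball, keeps it in \<open>X\<close> by convexity,
  and moves it by at most \<open>d\<close>.\<close>

lemma ball_slice_shift:
  fixes X :: "'a::real_normed_vector set"
  assumes "convex X" "b \<in> X" "0 \<le> R" and u: "u \<in> X" "norm (u - a) \<le> R"
  shows "\<exists>u'\<in>{x'\<in>X. norm (x' - b) \<le> R}. norm (u - u') \<le> norm (a - b)"
proof -
  define d where "d = norm (a - b)"
  \<comment> \<open>If \<open>R\<close> and \<open>d\<close> both vanish, division by zero makes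
    \<open>r\<close> zero; then \<open>u'\<close> is \<open>b\<close>, and \<open>u\<close>,
    \<open>a\<close>, \<open>b\<close> coincide.\<close>
  define r where "r = R / (R + d)"
  have d0: "0 \<le> d" by (simp add: d_def)
  have r: "0 \<le> r" "r \<le> 1" using d0 assms(3) by (auto simp: r_def divide_simps)
  have ub: "norm (u - b) \<le> R + d"
    using norm_triangle_ineq[of "u - a" "a - b"] u(2) by (simp add: d_def)
  define u' where "u' = (1 - r) *\<^sub>R b + r *\<^sub>R u"
  have "u' \<in> X"
    unfolding u'_def by (rule convexD[OF assms(1)]) (use r assms u in auto)
  moreover have "norm (u' - b) \<le> R"
  proof -
    have "norm (u' - b) = norm (r *\<^sub>R (u - b))"
      by (simp add: u'_def algebra_simps)
    also have "\<dots> = r * norm (u - b)" using r by simp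
    also have "\<dots> \<le> r * (R + d)" using ub r by (intro mult_left_mono) auto
    also have "\<dots> \<le> R" using d0 assms(3) by (auto simp: r_def)
    finally show ?thesis .
  qed
  moreover have "norm (u - u') \<le> d"
  proof -
    have "norm (u - u') = norm ((1 - r) *\<^sub>R (u - b))"
      by (simp add: u'_def algebra_simps)
    also have "\<dots> = (1 - r) * norm (u - b)" using r by simp
    also have "\<dots> \<le> (1 - r) * (R + d)" using ub r by (intro mult_left_mono) auto
    also have "\<dots> \<le> d" using d0 assms(3) by (cases "R + d = 0") (auto simp: r_def field_simps)
    finally show ?thesis .
  qed
  ultimately show ?thesis by (auto simp: d_def)
qed

text \<open>Each projection satisfies a variational inequality on its own slice only. Testing it at
  a point of that slice close to the other projection, as given by \<open>ball_slice_shift\<close>,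
  leaves an error linear in the distance of the centres. The square root obtained for the
  projections themselves is enough for continuity in the centre.\<close>

lemma closest_point_ball_slice_le:
  fixes X :: "'a::euclidean_space set"
  assumes X: "closed X" "convex X" and ab: "a \<in> X" "b \<in> X" and R: "0 \<le> R"
  shows "(norm (closest_point {x'\<in>X. norm (x' - a) \<le> R} w - closest_point {x'\<in>X. norm (x' - b) \<le> R} w))\<^sup>2
    \<le> norm (a - b) * (norm (w - a) + norm (w - b))"
proof -
  let ?A = "{x'\<in>X. norm (x' - a) \<le> R}" and ?B = "{x'\<in>X. norm (x' - b) \<le> R}"
  let ?d = "norm (a - b)"
  define p q where "p = closest_point ?A w" and "q = closest_point ?B w"
  have mem: "a \<in> ?A" "b \<in> ?B" using ab R by auto
  have cl: "closed ?A" "closed ?B" "convex ?A" "convex ?B"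
    by (intro closed_ball_slice convex_ball_slice X)+
  have pA: "p \<in> ?A" unfolding p_def by (rule closest_point_in_set[OF cl(1)]) (use mem in blast)
  have qB: "q \<in> ?B" unfolding q_def by (rule closest_point_in_set[OF cl(2)]) (use mem in blast)
  obtain p' where p': "p' \<in> ?B" "norm (p - p') \<le> ?d"
    using ball_slice_shift[OF X(2) ab(2) R, of p a] pA by auto
  obtain q' where q': "q' \<in> ?A" "norm (q - q') \<le> ?d"
    using ball_slice_shift[OF X(2) ab(1) R, of q b] qB by (auto simp: norm_minus_commute)
  have wp: "norm (w - p) \<le> norm (w - a)"
    using closest_point_le[OF cl(1) mem(1), of w] by (simp add: p_def dist_norm)
  have wq: "norm (w - q) \<le> norm (w - b)"
    using closest_point_le[OF cl(2) mem(2), of w] by (simp add: q_def dist_norm)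
  have 1: "(w - p) \<bullet> (q' - p) \<le> 0"
    unfolding p_def by (rule closest_point_dot[OF cl(3,1) q'(1)])
  have 2: "(w - q) \<bullet> (p' - q) \<le> 0"
    unfolding q_def by (rule closest_point_dot[OF cl(4,2) p'(1)])
  have "(w - p) \<bullet> (q - q') \<le> norm (w - p) * norm (q - q')"
    by (rule norm_cauchy_schwarz)
  also have "\<dots> \<le> norm (w - a) * ?d"
    using wp q' by (intro mult_mono) auto
  finally have 3: "(w - p) \<bullet> (q - q') \<le> norm (w - a) * ?d" .
  have "(w - q) \<bullet> (p - p') \<le> norm (w - q) * norm (p - p')"
    by (rule norm_cauchy_schwarz)
  also have "\<dots> \<le> norm (w - b) * ?d"
    using wq p' by (intro mult_mono) auto
  finally have 4: "(w - q) \<bullet> (p - p') \<le> norm (w - b) * ?d" .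
  have "(norm (p - q))\<^sup>2 = (w - p) \<bullet> (q' - p) + (w - p) \<bullet> (q - q') + (w - q) \<bullet> (p' - q) + (w - q) \<bullet> (p - p')"
    by (simp add: power2_norm_eq_inner inner_diff_left inner_diff_right inner_commute algebra_simps)
  also have "\<dots> \<le> norm (w - a) * ?d + norm (w - b) * ?d"
    using 1 2 3 4 by linarith
  finally show ?thesis
    by (simp add: p_def q_def algebra_simps)
qed

lemma continuous_on_closest_point_ball_slice:
  fixes X :: "'a::euclidean_space set"
  assumes X: "closed X" "convex X" and R: "0 \<le> R"
  shows "continuous_on (X \<times> UNIV) (\<lambda>(a, w). closest_point {x'\<in>X. norm (x' - a) \<le> R} w)"
proof -
  define pr where "pr a w = closest_point {x'\<in>X. norm (x' - a) \<le> R} w" for a w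
  have "continuous_on (X \<times> UNIV) (\<lambda>z. pr (fst z) (snd z))"
    unfolding continuous_on_def
  proof (intro ballI)
    fix z :: "'a \<times> 'a" assume z: "z \<in> X \<times> UNIV"
    obtain a w where aw: "z = (a, w)" by force
    have a: "a \<in> X" using z aw by auto
    \<comment> \<open>First the projected point moves at a fixed centre, which is nonexpansive; then
      the centre moves at a fixed projected point, which costs the square root.\<close>
    define h where "h y = sqrt (norm (fst y - a) * (norm (w - fst y) + norm (w - a))) + norm (snd y - w)" for y
    have "(h \<longlongrightarrow> sqrt (norm (a - a) * (norm (w - a) + norm (w - a))) + norm (w - w)) (at z within X \<times> UNIV)"
      unfolding h_def aw by (intro tendsto_intros) (auto intro!: tendsto_eq_intros)
    then have h: "(h \<longlongrightarrow> 0) (at z within X \<times> UNIV)" by simp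
    have "norm (pr (fst y) (snd y) - pr a w) \<le> h y" if "y \<in> X \<times> UNIV" for y
    proof -
      obtain b u where bu: "y = (b, u)" by force
      have b: "b \<in> X" using that bu by auto
      have "norm (pr b u - pr b w) \<le> norm (u - w)"
        unfolding pr_def using R b
        by (intro closest_point_lipschitz[unfolded dist_norm] convex_ball_slice closed_ball_slice X) auto
      moreover have "norm (pr b w - pr a w) \<le> sqrt (norm (b - a) * (norm (w - b) + norm (w - a)))"
        unfolding pr_def by (intro real_le_rsqrt closest_point_ball_slice_le X b a R)
      moreover have "norm (pr b u - pr a w) \<le> norm (pr b u - pr b w) + norm (pr b w - pr a w)"
        using norm_triangle_ineq[of "pr b u - pr b w" "pr b w - pr a w"] by simp
      ultimately show ?thesis by (simp add: h_def bu)
    qed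
    then have "\<forall>\<^sub>F y in at z within X \<times> UNIV. norm (pr (fst y) (snd y) - pr a w) \<le> h y"
      by (auto simp: eventually_at_filter)
    then have "((\<lambda>y. pr (fst y) (snd y) - pr a w) \<longlongrightarrow> 0) (at z within X \<times> UNIV)"
      by (rule Lim_null_comparison[OF _ h])
    then show "((\<lambda>z. pr (fst z) (snd z)) \<longlongrightarrow> pr (fst z) (snd z)) (at z within X \<times> UNIV)"
      using LIM_zero_cancel aw by fastforce
  qed
  then show ?thesis by (simp add: pr_def case_prod_beta')
qed

lemma closest_point_ball_slice_measurable:
  fixes X :: "'a::euclidean_space set"
  assumes X: "closed X" "convex X" and R: "0 \<le> R"
    and a: "a \<in> measurable Q (restrict_space borel X)" and w: "w \<in> borel_measurable Q"
  shows "(\<lambda>q. closest_point {x'\<in>X. norm (x' - a q) \<le> R} (w q)) \<in> measurable Q (restrict_space borel X)"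
proof -
  have aX: "a q \<in> X" if "q \<in> space Q" for q
    using measurable_space[OF a that] by (simp add: space_restrict_space)
  have ab: "a \<in> borel_measurable Q"
    using a by (simp add: measurable_restrict_space2_iff)
  have "(\<lambda>q. (a q, w q)) \<in> measurable Q (restrict_space borel (X \<times> UNIV))"
    using aX by (intro measurable_restrict_space2 borel_measurable_Pair ab w) auto
  moreover have "(\<lambda>(a, w). closest_point {x'\<in>X. norm (x' - a) \<le> R} w) \<in> borel_measurable (restrict_space borel (X \<times> UNIV))"
    by (intro borel_measurable_continuous_on_restrict continuous_on_closest_point_ball_slice X R)
  ultimately have "(\<lambda>q. closest_point {x'\<in>X. norm (x' - a q) \<le> R} (w q)) \<in> borel_measurable Q"
    by (auto dest: measurable_compose)
  moreover have "closest_point {x'\<in>X. norm (x' - a q) \<le> R} (w q) \<in> X" if "q \<in> space Q" for q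
    using closest_point_in_set[OF closed_ball_slice[OF X(1)], of "a q" R "w q"] aX[OF that] R by fastforce
  ultimately show ?thesis
    by (intro measurable_restrict_space2) auto
qed

subsection \<open>Chains driven by independent samples\<close>

context prob_space
begin

text \<open>\<open>W\<close> is a Markov chain with a deterministic start. It is instantiated by the
  iterates within a stage, by those iterates with a running sum attached, and by the start points of
  the stages, where one sample is a whole row of \<open>T\<close> draws.\<close>

context
  fixes Z :: "'z measure" and zeta :: "nat \<Rightarrow> 'a \<Rightarrow> 'z" and n :: nat
    and N :: "'s measure" and W :: "nat \<Rightarrow> 'a \<Rightarrow> 's" and F :: "nat \<Rightarrow> 's \<Rightarrow> 'z \<Rightarrow> 's" and w0 :: 's
  assumes indep: "indep_vars (\<lambda>_. Z) zeta {..<n}"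
    and init: "w0 \<in> space N" "\<And>\<omega>. \<omega> \<in> space M \<Longrightarrow> W 0 \<omega> = w0"
    and step: "\<And>k \<omega>. k < n \<Longrightarrow> \<omega> \<in> space M \<Longrightarrow> W (Suc k) \<omega> = F k (W k \<omega>) (zeta k \<omega>)"
    and F: "\<And>k. k < n \<Longrightarrow> (\<lambda>(w, z). F k w z) \<in> measurable (N \<Otimes>\<^sub>M Z) N"
begin

lemma sample_measurable: "k < n \<Longrightarrow> zeta k \<in> measurable M Z"
  using indep by (auto simp: indep_vars_def)

lemma chain_depends_on_past:
  "k \<le> n \<Longrightarrow> \<exists>U\<in>measurable (PiM {..<k} (\<lambda>_. Z)) N.
     \<forall>\<omega>\<in>space M. W k \<omega> = U (restrict (\<lambda>i. zeta i \<omega>) {..<k})"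
proof (induction k)
  case 0
  then show ?case
    using init by (intro bexI[of _ "\<lambda>_. w0"]) auto
next
  case (Suc k)
  from Suc.IH[OF Suc_leD[OF Suc.prems]] obtain U where U: "U \<in> measurable (PiM {..<k} (\<lambda>_. Z)) N"
    and WU': "\<forall>\<omega>\<in>space M. W k \<omega> = U (restrict (\<lambda>i. zeta i \<omega>) {..<k})" ..
  note WU = WU'[rule_format]
  let ?V = "\<lambda>r. F k (U (restrict r {..<k})) (r k)"
  have "(\<lambda>r. restrict r {..<k}) \<in> measurable (PiM {..<Suc k} (\<lambda>_. Z)) (PiM {..<k} (\<lambda>_. Z))"
    by (rule measurable_restrict_subset) auto
  from measurable_compose[OF this U]
  have past: "(\<lambda>r. U (restrict r {..<k})) \<in> measurable (PiM {..<Suc k} (\<lambda>_. Z)) N" .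
  have "(\<lambda>r. r k) \<in> measurable (PiM {..<Suc k} (\<lambda>_. Z)) Z"
    using measurable_component_singleton[of k "{..<Suc k}" "\<lambda>_. Z"] by simp
  from measurable_Pair[OF past this]
  have "(\<lambda>r. (U (restrict r {..<k}), r k)) \<in> measurable (PiM {..<Suc k} (\<lambda>_. Z)) (N \<Otimes>\<^sub>M Z)" .
  from measurable_compose[OF this F[of k]]
  have V: "?V \<in> measurable (PiM {..<Suc k} (\<lambda>_. Z)) N"
    using Suc.prems by simp
  have WV: "W (Suc k) \<omega> = ?V (restrict (\<lambda>i. zeta i \<omega>) {..<Suc k})" if "\<omega> \<in> space M" for \<omega>
  proof -
    have "restrict (restrict (\<lambda>i. zeta i \<omega>) {..<Suc k}) {..<k} = restrict (\<lambda>i. zeta i \<omega>) {..<k}"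
      by (auto simp: restrict_def)
    then show ?thesis
      using step[of k \<omega>] WU[of \<omega>] that Suc.prems by simp
  qed
  show ?case
    by (rule bexI[of _ ?V, OF _ V]) (rule ballI, rule WV)
qed

lemma chain_measurable:
  assumes "k \<le> n"
  shows "W k \<in> measurable M N"
proof -
  from chain_depends_on_past[OF assms] obtain U where U: "U \<in> measurable (PiM {..<k} (\<lambda>_. Z)) N"
    and WU': "\<forall>\<omega>\<in>space M. W k \<omega> = U (restrict (\<lambda>i. zeta i \<omega>) {..<k})" ..
  note WU = WU'[rule_format]
  have "(\<lambda>\<omega>. restrict (\<lambda>i. zeta i \<omega>) {..<k}) \<in> measurable M (PiM {..<k} (\<lambda>_. Z))"
    using assms by (intro measurable_restrict sample_measurable) auto
  from measurable_compose[OF this U] have "(\<lambda>\<omega>. U (restrict (\<lambda>i. zeta i \<omega>) {..<k})) \<in> measurable M N" .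
  moreover have "W k \<in> measurable M N \<longleftrightarrow> (\<lambda>\<omega>. U (restrict (\<lambda>i. zeta i \<omega>) {..<k})) \<in> measurable M N"
    by (rule measurable_cong) (rule WU)
  ultimately show ?thesis by blast
qed

text \<open>Independence is stated as a product law because states and samples have different types,
  while \<open>indep_var\<close> relates variables of one value type. The tuples \<open>?X\<close>
  and \<open>?Y\<close> do share a type; disjointness of their index sets makes them independent,
  and the law is then pushed forward by \<open>U\<close> and by evaluation at
  \<open>k\<close>.\<close>

lemma chain_indep_next:
  assumes "k < n"
  shows "distr M N (W k) \<Otimes>\<^sub>M distr M Z (zeta k) = distr M (N \<Otimes>\<^sub>M Z) (\<lambda>\<omega>. (W k \<omega>, zeta k \<omega>))"
proof -
  from chain_depends_on_past[OF less_imp_le[OF assms]] obtain U where U: "U \<in> measurable (PiM {..<k} (\<lambda>_. Z)) N"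
    and WU': "\<forall>\<omega>\<in>space M. W k \<omega> = U (restrict (\<lambda>i. zeta i \<omega>) {..<k})" ..
  note WU = WU'[rule_format]
  let ?A = "PiM {..<k} (\<lambda>_. Z)" and ?X = "\<lambda>\<omega>. restrict (\<lambda>i. zeta i \<omega>) {..<k}"
  let ?B = "PiM {k} (\<lambda>_. Z)" and ?Y = "\<lambda>\<omega>. restrict (\<lambda>i. zeta i \<omega>) {k}"
  have "indep_var ?A ?X ?B ?Y"
    using assms by (intro indep_var_restrict[OF indep]) auto
  then have X: "?X \<in> measurable M ?A" and Y: "?Y \<in> measurable M ?B"
    and joint: "distr M ?A ?X \<Otimes>\<^sub>M distr M ?B ?Y = distr M (?A \<Otimes>\<^sub>M ?B) (\<lambda>\<omega>. (?X \<omega>, ?Y \<omega>))"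
    by (auto simp: indep_var_distribution_eq)
  have ev: "(\<lambda>r. r k) \<in> measurable ?B Z" by simp
  have W: "distr (distr M ?A ?X) N U = distr M N (W k)"
    unfolding distr_distr[OF U X] by (rule distr_cong) (auto simp: WU)
  have z: "distr (distr M ?B ?Y) Z (\<lambda>r. r k) = distr M Z (zeta k)"
    unfolding distr_distr[OF ev Y] by (rule distr_cong) auto
  have zm: "zeta k \<in> measurable M Z" by (rule sample_measurable[OF assms])
  interpret Zk: prob_space "distr M Z (zeta k)" by (rule prob_space_distr[OF zm])
  have "distr M N (W k) \<Otimes>\<^sub>M distr M Z (zeta k)
      = distr (distr M ?A ?X \<Otimes>\<^sub>M distr M ?B ?Y) (N \<Otimes>\<^sub>M Z) (\<lambda>(r, r'). (U r, r' k))"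
    unfolding W[symmetric] z[symmetric]
    by (rule pair_measure_distr) (use U ev Zk.sigma_finite_measure_axioms in \<open>simp_all only: z measurable_distr_eq1\<close>)
  also have "\<dots> = distr M (N \<Otimes>\<^sub>M Z) ((\<lambda>(r, r'). (U r, r' k)) \<circ> (\<lambda>\<omega>. (?X \<omega>, ?Y \<omega>)))"
    unfolding joint
  proof (rule distr_distr)
    have "(\<lambda>p. U (fst p)) \<in> measurable (?A \<Otimes>\<^sub>M ?B) N" "(\<lambda>p. snd p k) \<in> measurable (?A \<Otimes>\<^sub>M ?B) Z"
      by (rule measurable_compose[OF measurable_fst U], rule measurable_compose[OF measurable_snd ev])
    then show "(\<lambda>(r, r'). (U r, r' k)) \<in> measurable (?A \<Otimes>\<^sub>M ?B) (N \<Otimes>\<^sub>M Z)"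
      unfolding case_prod_beta' by (rule measurable_Pair)
    show "(\<lambda>\<omega>. (?X \<omega>, ?Y \<omega>)) \<in> measurable M (?A \<Otimes>\<^sub>M ?B)"
      by (rule measurable_Pair[OF X Y])
  qed
  also have "\<dots> = distr M (N \<Otimes>\<^sub>M Z) (\<lambda>\<omega>. (W k \<omega>, zeta k \<omega>))"
    by (rule distr_cong) (auto simp: WU)
  finally show ?thesis .
qed

text \<open>By the product law and Tonelli the state can be frozen while the next sample is
  integrated. This replaces conditional expectation given the past.\<close>

lemma chain_nn_integral_step:
  assumes "k < n" and h: "(\<lambda>(w, z). h w z) \<in> borel_measurable (N \<Otimes>\<^sub>M Z)"
  shows "(\<integral>\<^sup>+\<omega>. h (W k \<omega>) (zeta k \<omega>) \<partial>M) = (\<integral>\<^sup>+\<omega>. (\<integral>\<^sup>+\<omega>'. h (W k \<omega>) (zeta k \<omega>') \<partial>M) \<partial>M)"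
proof -
  have ind: "random_variable N (W k)" "random_variable Z (zeta k)"
    "distr M N (W k) \<Otimes>\<^sub>M distr M Z (zeta k) = distr M (N \<Otimes>\<^sub>M Z) (\<lambda>\<omega>. (W k \<omega>, zeta k \<omega>))"
    using chain_indep_next[OF assms(1)] chain_measurable[of k] sample_measurable[of k] assms(1) by auto
  interpret Zk: prob_space "distr M Z (zeta k)" by (rule prob_space_distr) fact
  have "(\<integral>\<^sup>+\<omega>. h (W k \<omega>) (zeta k \<omega>) \<partial>M)
      = (\<integral>\<^sup>+p. (\<lambda>(w, z). h w z) p \<partial>(distr M N (W k) \<Otimes>\<^sub>M distr M Z (zeta k)))"
    unfolding ind(3) using ind(1,2) h by (subst nn_integral_distr) auto
  also have "\<dots> = (\<integral>\<^sup>+w. (\<integral>\<^sup>+z. h w z \<partial>distr M Z (zeta k)) \<partial>distr M N (W k))"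
    using h by (subst Zk.nn_integral_fst[symmetric]) auto
  also have "\<dots> = (\<integral>\<^sup>+\<omega>. (\<integral>\<^sup>+z. h (W k \<omega>) z \<partial>distr M Z (zeta k)) \<partial>M)"
    using h by (intro nn_integral_distr ind Zk.borel_measurable_nn_integral) auto
  also have "\<dots> = (\<integral>\<^sup>+\<omega>. (\<integral>\<^sup>+\<omega>'. h (W k \<omega>) (zeta k \<omega>') \<partial>M) \<partial>M)"
  proof (intro nn_integral_cong nn_integral_distr ind)
    fix \<omega> assume "\<omega> \<in> space M"
    then have "W k \<omega> \<in> space N" using ind(1) by (auto dest: measurable_space)
    from measurable_compose[OF measurable_Pair1'[OF this] h]
    show "h (W k \<omega>) \<in> borel_measurable (distr M Z (zeta k))" by simp
  qed
  finally show ?thesis .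
qed

text \<open>A supermartingale inequality whose drift condition is checked at each fixed state.
  Values in \<open>ennreal\<close> avoid integrability side conditions. It yields both the
  exponential bound of \<open>chain_azuma\<close> and the accounting of failures over the
  stages.\<close>

lemma chain_nn_integral_le:
  assumes Phi: "\<And>k. k \<le> n \<Longrightarrow> Phi k \<in> borel_measurable N"
    and drift: "\<And>k w. k < n \<Longrightarrow> w \<in> space N \<Longrightarrow> (\<integral>\<^sup>+\<omega>. Phi (Suc k) (F k w (zeta k \<omega>)) \<partial>M) \<le> Phi k w"
    and "k \<le> n"
  shows "(\<integral>\<^sup>+\<omega>. Phi k (W k \<omega>) \<partial>M) \<le> Phi 0 w0"
  using \<open>k \<le> n\<close>
proof (induction k)
  case 0
  have "(\<integral>\<^sup>+\<omega>. Phi 0 (W 0 \<omega>) \<partial>M) = (\<integral>\<^sup>+\<omega>. Phi 0 w0 \<partial>M)"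
    using init by (intro nn_integral_cong) auto
  then show ?case by (simp add: emeasure_space_1)
next
  case (Suc k)
  have k: "k < n" using Suc.prems by simp
  have "(\<integral>\<^sup>+\<omega>. Phi (Suc k) (W (Suc k) \<omega>) \<partial>M) = (\<integral>\<^sup>+\<omega>. Phi (Suc k) (F k (W k \<omega>) (zeta k \<omega>)) \<partial>M)"
    using step[OF k] by (intro nn_integral_cong) auto
  also have "\<dots> = (\<integral>\<^sup>+\<omega>. (\<integral>\<^sup>+\<omega>'. Phi (Suc k) (F k (W k \<omega>) (zeta k \<omega>')) \<partial>M) \<partial>M)"
    using measurable_compose[OF F[OF k] Phi[OF Suc.prems]]
    by (intro chain_nn_integral_step k) (simp add: case_prod_beta')
  also have "\<dots> \<le> (\<integral>\<^sup>+\<omega>. Phi k (W k \<omega>) \<partial>M)"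
    using measurable_space[OF chain_measurable[of k]] k by (intro nn_integral_mono drift) auto
  finally show ?case using Suc by simp
qed

end

lemma chain_azuma:
  fixes Z :: "'z measure" and N :: "'s measure" and D :: "nat \<Rightarrow> 's \<Rightarrow> 'z \<Rightarrow> real"
  assumes indep: "indep_vars (\<lambda>_. Z) zeta {..<n}"
    and init: "w0 \<in> space N" "\<And>\<omega>. \<omega> \<in> space M \<Longrightarrow> W 0 \<omega> = w0"
    and step: "\<And>k \<omega>. k < n \<Longrightarrow> \<omega> \<in> space M \<Longrightarrow> W (Suc k) \<omega> = F k (W k \<omega>) (zeta k \<omega>)"
    and F: "\<And>k. k < n \<Longrightarrow> (\<lambda>(w, z). F k w z) \<in> measurable (N \<Otimes>\<^sub>M Z) N"
    and D: "\<And>k. k < n \<Longrightarrow> (\<lambda>(w, z). D k w z) \<in> borel_measurable (N \<Otimes>\<^sub>M Z)"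
    and bound: "\<And>k w z. k < n \<Longrightarrow> w \<in> space N \<Longrightarrow> z \<in> space Z \<Longrightarrow> \<bar>D k w z\<bar> \<le> K"
    and mean: "\<And>k w. k < n \<Longrightarrow> w \<in> space N \<Longrightarrow> expectation (\<lambda>\<omega>. D k w (zeta k \<omega>)) = 0"
    and pos: "0 < n" "0 < K" "0 < a"
  shows "{\<omega>\<in>space M. a \<le> (\<Sum>k<n. D k (W k \<omega>) (zeta k \<omega>))} \<in> events" (is ?events)
    and "prob {\<omega>\<in>space M. a \<le> (\<Sum>k<n. D k (W k \<omega>) (zeta k \<omega>))} \<le> exp (- a\<^sup>2 / (2 * real n * K\<^sup>2))" (is ?prob)
proof -
  \<comment> \<open>This value minimises the exponent
    \<open>- (r * a) + real n * (r\<^sup>2 * K\<^sup>2 / 2)\<close> that appears at the end.\<close>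
  define r where "r = a / (real n * K\<^sup>2)"
  have r: "0 < r" using pos by (simp add: r_def)
  \<comment> \<open>The running sum becomes part of the state, so that the exponential of the sum is
    a function of a chain.\<close>
  define V where "V k \<omega> = (W k \<omega>, \<Sum>i<k. D i (W i \<omega>) (zeta i \<omega>))" for k \<omega>
  define FV where "FV k v z = (F k (fst v) z, snd v + D k (fst v) z)" for k and v :: "'s \<times> real" and z
  \<comment> \<open>Every remaining step carries in advance the factor that Hoeffding's lemma
    charges for it: a centred variable with values between \<open>- K\<close> and \<open>K\<close>
    has exponential moment at most \<open>exp (r\<^sup>2 * K\<^sup>2 / 2)\<close>. This makes
    \<open>Phi\<close> nonincreasing in expectation.\<close>
  define Phi where "Phi k v = ennreal (exp (r * snd v + real (n - k) * (r\<^sup>2 * K\<^sup>2 / 2)))" for k and v :: "'s \<times> real"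
  have Wm: "W k \<in> measurable M N" if "k \<le> n" for k
    by (rule chain_measurable[where F = F and Z = Z and zeta = zeta and n = n and ?w0.0 = w0])
      (fact indep init step F that)+
  have zm: "zeta k \<in> measurable M Z" if "k < n" for k
    using indep that by (auto simp: indep_vars_def)
  have fst_z: "(\<lambda>p. (fst (fst p), snd p)) \<in> measurable ((N \<Otimes>\<^sub>M borel) \<Otimes>\<^sub>M Z) (N \<Otimes>\<^sub>M Z)"
    by measurable
  have FVm: "(\<lambda>(v, z). FV k v z) \<in> measurable ((N \<Otimes>\<^sub>M borel) \<Otimes>\<^sub>M Z) (N \<Otimes>\<^sub>M borel)" if "k < n" for k
  proof -
    have "(\<lambda>p. F k (fst (fst p)) (snd p)) \<in> measurable ((N \<Otimes>\<^sub>M borel) \<Otimes>\<^sub>M Z) N"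
      using measurable_compose[OF fst_z F[OF that]] by simp
    moreover have "(\<lambda>p. D k (fst (fst p)) (snd p)) \<in> borel_measurable ((N \<Otimes>\<^sub>M borel) \<Otimes>\<^sub>M Z)"
      using measurable_compose[OF fst_z D[OF that]] by simp
    moreover have "(\<lambda>p. snd (fst p)) \<in> borel_measurable ((N \<Otimes>\<^sub>M (borel :: real measure)) \<Otimes>\<^sub>M Z)"
      by measurable
    ultimately show ?thesis
      unfolding FV_def case_prod_beta' by (intro measurable_Pair borel_measurable_add) auto
  qed
  have drift: "(\<integral>\<^sup>+\<omega>. Phi (Suc k) (FV k v (zeta k \<omega>)) \<partial>M) \<le> Phi k v"
    if k: "k < n" and v: "v \<in> space (N \<Otimes>\<^sub>M borel)" for k v
  proof -
    have w: "fst v \<in> space N" using v by (auto simp: space_pair_measure)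
    have Dm: "(\<lambda>\<omega>. D k (fst v) (zeta k \<omega>)) \<in> borel_measurable M"
      using measurable_compose[OF zm[OF k] measurable_compose[OF measurable_Pair1'[OF w] D[OF k]]] by simp
    have "\<bar>D k (fst v) (zeta k \<omega>)\<bar> \<le> K" if "\<omega> \<in> space M" for \<omega>
      using bound[OF k w] measurable_space[OF zm[OF k] that] by blast
    then interpret B: interval_bounded_random_variable M "\<lambda>\<omega>. D k (fst v) (zeta k \<omega>)" "-K" K
      by unfold_locales (use Dm in \<open>auto simp: abs_le_iff minus_le_iff\<close>)
    have "(\<integral>\<^sup>+\<omega>. Phi (Suc k) (FV k v (zeta k \<omega>)) \<partial>M)
        = (\<integral>\<^sup>+\<omega>. ennreal (exp (r * snd v + real (n - Suc k) * (r\<^sup>2 * K\<^sup>2 / 2))) *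
              ennreal (exp (r * D k (fst v) (zeta k \<omega>))) \<partial>M)"
      by (intro nn_integral_cong)
        (simp add: Phi_def FV_def ennreal_mult[symmetric] exp_add[symmetric] algebra_simps)
    also have "\<dots> = ennreal (exp (r * snd v + real (n - Suc k) * (r\<^sup>2 * K\<^sup>2 / 2))) *
        (\<integral>\<^sup>+\<omega>. ennreal (exp (r * D k (fst v) (zeta k \<omega>))) \<partial>M)"
      using Dm by (intro nn_integral_cmult) auto
    also have "\<dots> \<le> ennreal (exp (r * snd v + real (n - Suc k) * (r\<^sup>2 * K\<^sup>2 / 2))) *
        ennreal (exp (r\<^sup>2 * (K - - K)\<^sup>2 / 8))"
      by (intro mult_left_mono B.Hoeffdings_lemma_nn_integral_0[OF r mean[OF k w]]) auto
    also have "\<dots> = Phi k v"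
    proof -
      obtain j where "n = Suc k + j" using k by (auto simp: less_iff_Suc_add)
      then show ?thesis
        by (simp add: Phi_def ennreal_mult[symmetric] exp_add[symmetric] algebra_simps power2_eq_square)
    qed
    finally show ?thesis .
  qed
  have main: "(\<integral>\<^sup>+\<omega>. Phi n (V n \<omega>) \<partial>M) \<le> Phi 0 (w0, 0)"
  proof (rule chain_nn_integral_le[OF indep, where N = "N \<Otimes>\<^sub>M borel" and F = FV and W = V])
    show "(w0, 0) \<in> space (N \<Otimes>\<^sub>M borel)" using init by (simp add: space_pair_measure)
    show "\<And>\<omega>. \<omega> \<in> space M \<Longrightarrow> V 0 \<omega> = (w0, 0)" using init by (simp add: V_def)
    show "\<And>k \<omega>. k < n \<Longrightarrow> \<omega> \<in> space M \<Longrightarrow> V (Suc k) \<omega> = FV k (V k \<omega>) (zeta k \<omega>)"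
      using step by (simp add: V_def FV_def)
    show "\<And>k. k < n \<Longrightarrow> (\<lambda>(v, z). FV k v z) \<in> measurable ((N \<Otimes>\<^sub>M borel) \<Otimes>\<^sub>M Z) (N \<Otimes>\<^sub>M borel)"
      by (rule FVm)
    show "Phi k \<in> borel_measurable (N \<Otimes>\<^sub>M borel)" for k unfolding Phi_def by measurable
  qed (use drift in auto)
  let ?S = "\<lambda>\<omega>. \<Sum>k<n. D k (W k \<omega>) (zeta k \<omega>)"
  have Sm: "?S \<in> borel_measurable M"
  proof (intro borel_measurable_sum)
    fix k assume "k \<in> {..<n}"
    then have "k < n" by simp
    then show "(\<lambda>\<omega>. D k (W k \<omega>) (zeta k \<omega>)) \<in> borel_measurable M"
      using measurable_compose[OF measurable_Pair[OF Wm zm] D, of k k k] by simp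
  qed
  then show ?events by measurable
  have "emeasure M {\<omega>\<in>space M. a \<le> ?S \<omega>}
      = emeasure M {\<omega>\<in>space M. 1 \<le> ennreal (exp (- (r * a))) * ennreal (exp (r * ?S \<omega>))}"
    using r by (intro arg_cong[where f = "emeasure M"] Collect_cong conj_cong refl)
      (simp add: ennreal_mult[symmetric] exp_add[symmetric] ennreal_1[symmetric] del: ennreal_1)
  also have "\<dots> \<le> ennreal (exp (- (r * a))) * (\<integral>\<^sup>+\<omega>. ennreal (exp (r * ?S \<omega>)) * indicator (space M) \<omega> \<partial>M)"
    using Sm by (intro nn_integral_Markov_inequality) auto
  also have "(\<integral>\<^sup>+\<omega>. ennreal (exp (r * ?S \<omega>)) * indicator (space M) \<omega> \<partial>M) = (\<integral>\<^sup>+\<omega>. Phi n (V n \<omega>) \<partial>M)"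
    by (intro nn_integral_cong) (simp add: Phi_def V_def)
  also have "ennreal (exp (- (r * a))) * \<dots> \<le> ennreal (exp (- (r * a))) * Phi 0 (w0, 0)"
    by (intro mult_left_mono main) auto
  also have "\<dots> = ennreal (exp (- (r * a) + real n * (r\<^sup>2 * K\<^sup>2 / 2)))"
    by (simp add: Phi_def ennreal_mult[symmetric] exp_add[symmetric] algebra_simps)
  also have "- (r * a) + real n * (r\<^sup>2 * K\<^sup>2 / 2) = - a\<^sup>2 / (2 * real n * K\<^sup>2)"
    using pos by (simp add: r_def field_simps power2_eq_square)
  finally show ?prob
    by (simp add: emeasure_eq_measure)
qed

end

subsection \<open>Conjugates of uniformly convex functions\<close>

locale conjugate_pair =
  fixes Y :: "'b::euclidean_space set" and phis phi :: "'b \<Rightarrow> real" and p lam v L :: real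
  assumes conj: "convex_conjugate (extend_infty Y phis) = (\<lambda>u. ereal (phi u))"
      "convex_conjugate (\<lambda>u. ereal (phi u)) = extend_infty Y phis"
    and unif: "2 \<le> p" "0 < lam" "uniformly_convex_on Y p lam phis"
    and v: "v = 1 / (p - 1)" and L: "L = (1 / lam) powr v"
begin

lemma v_pos: "0 < v" and v_le_1: "v \<le> 1" and L_pos: "0 < L"
  using unif by (auto simp: v L divide_simps)

lemma fenchel_young: "y \<in> Y \<Longrightarrow> y \<bullet> u - phis y \<le> phi u"
proof -
  assume "y \<in> Y"
  then have "ereal (y \<bullet> u - phis y) \<le> convex_conjugate (extend_infty Y phis) u"
    unfolding convex_conjugate_def by (intro SUP_upper2[of y]) (auto simp: extend_infty_def)
  then show ?thesis by (simp add: conj)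
qed

text \<open>Near maximisers stay bounded because \<open>phi\<close> is finite at all points
  \<open>u + b\<close> and \<open>u - b\<close> with \<open>b\<close> a basis vector. A limit
  \<open>y\<close> of them satisfies
  \<open>y \<bullet> w - phi w \<le> y \<bullet> u - phi u\<close> for all \<open>w\<close>; the
  supremum over \<open>w\<close> is the biconjugate at \<open>y\<close>. Hence the extended
  \<open>phis\<close> is finite at \<open>y\<close>, so \<open>y\<close> lies in \<open>Y\<close>
  and attains the value.\<close>

lemma conjugate_attained: "\<exists>y\<in>Y. phi u = y \<bullet> u - phis y"
proof -
  have "\<exists>y. y \<in> Y \<and> phi u - 1 / real (Suc n) < y \<bullet> u - phis y" for n
  proof -
    have "ereal (phi u - 1 / real (Suc n)) < convex_conjugate (extend_infty Y phis) u"
      by (simp add: conj)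
    then obtain y where "ereal (phi u - 1 / real (Suc n)) < ereal (y \<bullet> u) - extend_infty Y phis y"
      unfolding convex_conjugate_def less_SUP_iff by auto
    then show ?thesis
      by (intro exI[of _ y]) (auto simp: extend_infty_def split: if_splits)
  qed
  then obtain q where q: "\<And>n. q n \<in> Y" "\<And>n. phi u - 1 / real (Suc n) < q n \<bullet> u - phis (q n)"
    by metis
  have q_le: "q n \<bullet> w - phi w \<le> q n \<bullet> u - phi u + 1 / real (Suc n)" for n w
    using fenchel_young[OF q(1), of n w] q(2)[of n] by linarith
  \<comment> \<open>Inserting \<open>u + b\<close> and \<open>u - b\<close> for \<open>w\<close> in
    \<open>q_le\<close> bounds each coordinate of \<open>q n\<close> from both sides; the summand 1
    dominates the slack \<open>1 / real (Suc n)\<close>.\<close>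
  define K where "K = (\<Sum>b\<in>Basis. max (phi (u + b) - phi u + 1) (phi (u - b) - phi u + 1))"
  have "norm (q n) \<le> K" for n
  proof -
    have one: "1 / real (Suc n) \<le> 1" by simp
    have "\<bar>q n \<bullet> b\<bar> \<le> max (phi (u + b) - phi u + 1) (phi (u - b) - phi u + 1)" for b
      using q_le[of n "u + b"] q_le[of n "u - b"] one unfolding inner_add_right inner_diff_right by linarith
    then have "(\<Sum>b\<in>Basis. \<bar>q n \<bullet> b\<bar>) \<le> K" unfolding K_def by (intro sum_mono) auto
    then show ?thesis using norm_le_l1[of "q n"] by linarith
  qed
  then have "bounded (range q)" by (auto simp: bounded_iff)
  then obtain y r where r: "strict_mono (r :: nat \<Rightarrow> nat)" and y: "(q \<circ> r) \<longlonglongrightarrow> y"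
    using bounded_imp_convergent_subsequence by blast
  have le: "y \<bullet> w - phi w \<le> y \<bullet> u - phi u" for w
  proof (rule LIMSEQ_le)
    show "(\<lambda>n. (q \<circ> r) n \<bullet> w - phi w) \<longlonglongrightarrow> y \<bullet> w - phi w"
      by (intro tendsto_intros y)
    have "(\<lambda>n. 1 / real (Suc (r n))) \<longlonglongrightarrow> 0"
      using LIMSEQ_subseq_LIMSEQ[OF LIMSEQ_inverse_real_of_nat r] by (simp add: comp_def inverse_eq_divide)
    then have "(\<lambda>n. (q \<circ> r) n \<bullet> u - phi u + 1 / real (Suc (r n))) \<longlonglongrightarrow> y \<bullet> u - phi u + 0"
      by (intro tendsto_intros y)
    then show "(\<lambda>n. (q \<circ> r) n \<bullet> u - phi u + 1 / real (Suc (r n))) \<longlonglongrightarrow> y \<bullet> u - phi u" by simp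
    show "\<exists>N. \<forall>n\<ge>N. (q \<circ> r) n \<bullet> w - phi w \<le> (q \<circ> r) n \<bullet> u - phi u + 1 / real (Suc (r n))"
      using q_le by auto
  qed
  have "extend_infty Y phis y = (SUP w. ereal (w \<bullet> y) - ereal (phi w))"
    unfolding conj(2)[symmetric] convex_conjugate_def ..
  also have "\<dots> \<le> ereal (y \<bullet> u - phi u)"
    using le by (intro SUP_least) (simp add: inner_commute)
  finally have "y \<in> Y" "phis y \<le> y \<bullet> u - phi u"
    by (auto simp: extend_infty_def split: if_splits)
  then show ?thesis
    using fenchel_young[of y u] by (intro bexI[of _ y]) auto
qed

text \<open>This is the gradient of \<open>phi\<close>, as \<open>phi_holder_gradient\<close> shows.
  It is written with the same \<open>arg_max\<close> as \<open>dual_map\<close>, so that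
  \<open>A x\<close> is \<open>grad (l x)\<close> by definition.\<close>

definition grad :: "'b \<Rightarrow> 'b" where
  "grad u = arg_max (\<lambda>y. y \<bullet> u - phis y) (\<lambda>y. y \<in> Y)"

lemma grad_in: "grad u \<in> Y" and grad_eq: "phi u = grad u \<bullet> u - phis (grad u)"
proof -
  obtain y where y: "y \<in> Y" "phi u = y \<bullet> u - phis y" using conjugate_attained by blast
  then have "is_arg_max (\<lambda>y. y \<bullet> u - phis y) (\<lambda>y. y \<in> Y) y"
    using fenchel_young[of _ u] by (auto simp: is_arg_max_def not_less)
  then have *: "is_arg_max (\<lambda>y. y \<bullet> u - phis y) (\<lambda>y. y \<in> Y) (grad u)"
    unfolding grad_def arg_max_def by (rule someI)
  then show "grad u \<in> Y" by (simp add: is_arg_max_def)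
  then show "phi u = grad u \<bullet> u - phis (grad u)"
    using * y fenchel_young[of "grad u" u] by (force simp: is_arg_max_def)
qed

text \<open>Maximality of \<open>grad u\<close> says that \<open>u\<close> is a subgradient of
  \<open>phis\<close> there. Adding the uniform convexity inequalities at the two maximisers merges
  the two halves of \<open>lam\<close> and bounds \<open>lam * r powr p\<close> by
  \<open>d * r\<close>. Dividing by \<open>r\<close> and raising to the power \<open>v\<close>, the
  inverse of \<open>p - 1\<close>, produces the constant \<open>L\<close>.\<close>

lemma grad_holder: "norm (grad u1 - grad u2) \<le> L * norm (u1 - u2) powr v"
proof -
  have sub: "subgradient_on Y phis (grad u) u" for u
    unfolding subgradient_on_def using grad_in grad_eq[of u] fenchel_young[of _ u]
    by (auto simp: inner_diff_right inner_commute) (smt (verit, best) inner_commute)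
  let ?y1 = "grad u1" and ?y2 = "grad u2"
  define r d where "r = norm (?y1 - ?y2)" and "d = norm (u1 - u2)"
  have "phis ?y1 \<ge> phis ?y2 + u2 \<bullet> (?y1 - ?y2) + lam / 2 * r powr p"
    "phis ?y2 \<ge> phis ?y1 + u1 \<bullet> (?y2 - ?y1) + lam / 2 * r powr p"
    using unif(3) sub grad_in unfolding uniformly_convex_on_def r_def by (blast, metis norm_minus_commute)
  then have "lam * r powr p \<le> (u1 - u2) \<bullet> (?y1 - ?y2)"
    by (simp add: inner_diff_left inner_diff_right field_simps)
  also have "\<dots> \<le> d * r" unfolding d_def r_def by (rule norm_cauchy_schwarz)
  finally have main: "lam * r powr p \<le> d * r" .
  show ?thesis
  proof (cases "r = 0")
    case True
    then show ?thesis using L_pos by (simp add: r_def)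
  next
    case False
    then have r: "0 < r" by (simp add: r_def)
    have "r powr p = r powr (p - 1) * r"
      using r powr_add[of r "p - 1" 1] by simp
    then have "lam * r powr (p - 1) \<le> d" using main r by simp
    then have "r powr (p - 1) \<le> 1 / lam * d" using unif(2) by (simp add: field_simps)
    then have "(r powr (p - 1)) powr v \<le> (1 / lam * d) powr v"
      using v_pos by (intro powr_mono2) auto
    moreover have "(r powr (p - 1)) powr v = r"
      using r unif(1) by (simp add: powr_powr v)
    moreover have "(1 / lam * d) powr v = L * d powr v"
      unfolding L using unif(2) by (intro powr_mult)
    ultimately show ?thesis by (simp add: r_def d_def)
  qed
qed

text \<open>Applying \<open>fenchel_young\<close> at the maximisers of \<open>u\<close> and of
  \<open>w\<close> puts the first-order remainder between 0 and
  \<open>(grad w - grad u) \<bullet> (w - u)\<close>. Hoelder continuity of \<open>grad\<close>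
  therefore already gives differentiability.\<close>

lemma phi_holder_gradient: "holder_gradient L v phi"
  unfolding holder_gradient_def
proof (intro exI[of _ grad] conjI allI grad_holder)
  fix u
  have bnd: "norm (phi w - phi u - (w - u) \<bullet> grad u) / norm (w - u) \<le> L * norm (w - u) powr v" for w
  proof (cases "w = u")
    case False
    have lo: "0 \<le> phi w - phi u - (w - u) \<bullet> grad u"
      using fenchel_young[OF grad_in, of u w] grad_eq[of u]
      by (simp add: inner_diff_left inner_commute)
    have "phi w - phi u - (w - u) \<bullet> grad u \<le> (grad w - grad u) \<bullet> (w - u)"
      using fenchel_young[OF grad_in, of w u] grad_eq[of w]
      by (simp add: inner_diff_left inner_diff_right inner_commute)
    also have "\<dots> \<le> norm (grad w - grad u) * norm (w - u)"
      by (rule norm_cauchy_schwarz)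
    also have "\<dots> \<le> L * norm (w - u) powr v * norm (w - u)"
      by (intro mult_right_mono grad_holder) auto
    finally show ?thesis using False lo by (simp add: divide_le_eq)
  qed (use L_pos in simp)
  have "((\<lambda>w. L * norm (w - u) powr v) \<longlongrightarrow> L * norm (u - u) powr v) (at u)"
    using v_pos by (intro tendsto_intros tendsto_powr2) auto
  then have "((\<lambda>w. L * norm (w - u) powr v) \<longlongrightarrow> 0) (at u)" using v_pos by simp
  then have "((\<lambda>w. norm (phi w - phi u - (w - u) \<bullet> grad u) / norm (w - u)) \<longlongrightarrow> 0) (at u)"
    by (rule Lim_null_comparison[rotated]) (use bnd in auto)
  then show "GDERIV phi u :> grad u"
    unfolding gderiv_def has_derivative_iff_norm by (simp add: bounded_linear_inner_left)
qed

end

subsection \<open>The primal objective\<close>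

text \<open>Convexity in the primal variable enters as \<open>sub\<close>, a subgradient at every
  point of \<open>X\<close>. In the end the mean of the stochastic oracle supplies it.\<close>

locale saddle_problem = conjugate_pair Y phis phi p lam v L
  for Y :: "'b::euclidean_space set" and phis phi p lam v L +
  fixes X :: "'a::euclidean_space set" and l :: "'a \<Rightarrow> 'b" and g :: "'a \<Rightarrow> real" and G :: real
  assumes X: "closed X" "convex X"
    and sub: "\<And>x y. x \<in> X \<Longrightarrow> y \<in> Y \<Longrightarrow> \<exists>d. subgradient_on X (\<lambda>x'. saddle_obj l phis g x' y) x d"
    and lip: "G-lipschitz_on X l"
    and min: "minimizers X (primal_obj l phi g) \<noteq> {}"
begin

abbreviation f where "f \<equiv> saddle_obj l phis g"
abbreviation P where "P \<equiv> primal_obj l phi g"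
abbreviation A where "A \<equiv> dual_map l phis Y"
abbreviation Pmin where "Pmin \<equiv> min_value X P"

lemma dual_map_eq_grad: "A x = grad (l x)"
  by (simp add: dual_map_def grad_def)

lemma dual_map_in: "A x \<in> Y"
  by (simp add: dual_map_eq_grad grad_in)

lemma primal_eq_saddle: "P x = f x (A x)"
  using grad_eq[of "l x"] by (simp add: primal_obj_def saddle_obj_def dual_map_eq_grad)

lemma saddle_le_primal: "y \<in> Y \<Longrightarrow> f x y \<le> P x"
  using fenchel_young[of y "l x"] by (simp add: primal_obj_def saddle_obj_def)

lemma dual_map_holder:
  assumes "x1 \<in> X" "x2 \<in> X"
  shows "norm (A x1 - A x2) \<le> L * G powr v * norm (x1 - x2) powr v"
proof -
  have G: "0 \<le> G" using lip by (rule lipschitz_on_nonneg)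
  have "norm (l x1 - l x2) powr v \<le> (G * norm (x1 - x2)) powr v"
    using lipschitz_onD[OF lip assms] v_pos by (intro powr_mono2) (auto simp: dist_norm)
  also have "\<dots> = G powr v * norm (x1 - x2) powr v"
    using G by (simp add: powr_mult)
  finally have "L * norm (l x1 - l x2) powr v \<le> L * (G powr v * norm (x1 - x2) powr v)"
    using L_pos by simp
  then show ?thesis
    using grad_holder[of "l x1" "l x2"] by (simp add: dual_map_eq_grad mult.assoc)
qed

lemma continuous_on_dual_map: "continuous_on X A"
  unfolding continuous_on_def
proof (intro ballI)
  fix x assume x: "x \<in> X"
  have "((\<lambda>z. L * G powr v * norm (z - x) powr v) \<longlongrightarrow> L * G powr v * norm (x - x) powr v) (at x within X)"
    using v_pos by (intro tendsto_intros tendsto_powr2) auto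
  then have lim: "((\<lambda>z. L * G powr v * norm (z - x) powr v) \<longlongrightarrow> 0) (at x within X)"
    using v_pos by simp
  have "\<forall>\<^sub>F z in at x within X. norm (A z - A x) \<le> L * G powr v * norm (z - x) powr v"
    using dual_map_holder x by (auto simp: eventually_at_filter)
  then have "((\<lambda>z. A z - A x) \<longlongrightarrow> 0) (at x within X)"
    by (rule Lim_null_comparison[OF _ lim])
  then show "(A \<longlongrightarrow> A x) (at x within X)" by (rule LIM_zero_cancel)
qed

text \<open>The function \<open>f x' (A x)\<close> of \<open>x'\<close> lies below \<open>P\<close>
  and touches it at \<open>x\<close>, so its subgradients at \<open>x\<close> are subgradients of
  \<open>P\<close>.\<close>

lemma primal_subgradient: "x \<in> X \<Longrightarrow> \<exists>d. \<forall>z\<in>X. P x + d \<bullet> (z - x) \<le> P z"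
proof -
  assume x: "x \<in> X"
  obtain d where "subgradient_on X (\<lambda>x'. f x' (A x)) x d"
    using sub[OF x dual_map_in] by blast
  then have "\<forall>z\<in>X. P x + d \<bullet> (z - x) \<le> P z"
    using saddle_le_primal[OF dual_map_in] unfolding subgradient_on_def primal_eq_saddle[of x]
    by (meson order_trans)
  then show ?thesis ..
qed

text \<open>The affine minorant at the limit point is continuous and stays below \<open>a\<close>
  along the sequence; this is lower semicontinuity of \<open>P\<close>, drawn from subgradients
  alone.\<close>

lemma closed_primal_sublevel: "closed {x\<in>X. P x \<le> a}"
  unfolding closed_sequential_limits
proof (intro allI impI, elim conjE)
  fix xs x assume xs: "\<forall>n. xs n \<in> {x \<in> X. P x \<le> a}" and lim: "xs \<longlonglongrightarrow> x"
  have x: "x \<in> X" using closed_sequentially[OF X(1) _ lim] xs by auto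
  obtain d where d: "\<And>z. z \<in> X \<Longrightarrow> P x + d \<bullet> (z - x) \<le> P z"
    using primal_subgradient[OF x] by blast
  have "(\<lambda>n. P x + d \<bullet> (xs n - x)) \<longlonglongrightarrow> P x + d \<bullet> (x - x)"
    by (intro tendsto_intros lim)
  moreover have "P x + d \<bullet> (xs n - x) \<le> a" for n
    by (rule order_trans[OF d]) (use xs in auto)
  ultimately have "P x + d \<bullet> (x - x) \<le> a" by (intro LIMSEQ_le_const2) auto
  then have "P x \<le> a" by simp
  then show "x \<in> {x \<in> X. P x \<le> a}" using x by simp
qed

lemma primal_measurable: "P \<in> borel_measurable (restrict_space borel X)"
proof (rule borel_measurableI_le)
  fix a
  have "{x \<in> space (restrict_space borel X). P x \<le> a} = {x\<in>X. P x \<le> a}"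
    by (simp add: space_restrict_space)
  also have "\<dots> \<in> sets (restrict_space borel X)"
    using closed_primal_sublevel[of a] X(1) by (subst sets_restrict_space_iff) auto
  finally show "{x \<in> space (restrict_space borel X). P x \<le> a} \<in> sets (restrict_space borel X)" .
qed

lemma primal_segment:
  assumes x: "x \<in> X" "z \<in> X" and t: "0 \<le> t" "t \<le> 1"
  shows "P ((1 - t) *\<^sub>R z + t *\<^sub>R x) \<le> (1 - t) * P z + t * P x"
proof -
  define w where "w = (1 - t) *\<^sub>R z + t *\<^sub>R x"
  have "w \<in> X" unfolding w_def using X(2) x t by (intro convexD) auto
  then obtain d where d: "\<And>u. u \<in> X \<Longrightarrow> P w + d \<bullet> (u - w) \<le> P u"
    using primal_subgradient by blast
  have "(1 - t) * (P w + d \<bullet> (z - w)) + t * (P w + d \<bullet> (x - w)) \<le> (1 - t) * P z + t * P x"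
    using d[OF x(1)] d[OF x(2)] t by (intro add_mono mult_left_mono) auto
  moreover have "(1 - t) * (P w + d \<bullet> (z - w)) + t * (P w + d \<bullet> (x - w))
      = P w + d \<bullet> ((1 - t) *\<^sub>R z + t *\<^sub>R x - w)"
    by (simp add: inner_diff_right inner_add_right algebra_simps)
  ultimately show ?thesis by (simp add: w_def)
qed

lemma average_in:
  assumes "0 < T" "\<And>t. t < T \<Longrightarrow> w t \<in> X"
  shows "(1 / real T) *\<^sub>R (\<Sum>t<T. w t) \<in> X"
proof -
  have "(\<Sum>t<T. (1 / real T) *\<^sub>R w t) \<in> X"
    using assms by (intro convex_sum X) auto
  then show ?thesis by (simp add: scaleR_sum_right)
qed

lemma saddle_average_le:
  assumes T: "0 < T" and w: "\<And>t. t < T \<Longrightarrow> w t \<in> X" and y: "y \<in> Y"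
  shows "real T * f ((1 / real T) *\<^sub>R (\<Sum>t<T. w t)) y \<le> (\<Sum>t<T. f (w t) y)"
proof -
  let ?m = "(1 / real T) *\<^sub>R (\<Sum>t<T. w t)"
  obtain d where "subgradient_on X (\<lambda>x'. f x' y) ?m d"
    using sub[OF average_in[OF T, of w] y] w by blast
  then have "(\<Sum>t<T. f ?m y + d \<bullet> (w t - ?m)) \<le> (\<Sum>t<T. f (w t) y)"
    using w by (intro sum_mono) (auto simp: subgradient_on_def)
  moreover have "(\<Sum>t<T. f ?m y + d \<bullet> (w t - ?m)) = real T * f ?m y + d \<bullet> ((\<Sum>t<T. w t) - real T *\<^sub>R ?m)"
    by (simp add: sum.distrib inner_diff_right sum_subtractf inner_sum_right)
  ultimately show ?thesis using T by simp
qed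

lemma Pmin_attained: "z \<in> minimizers X P \<Longrightarrow> z \<in> X \<and> P z = Pmin"
  and Pmin_le: "x \<in> X \<Longrightarrow> Pmin \<le> P x"
proof -
  have *: "z \<in> X \<and> P z = Pmin" if "z \<in> minimizers X P" for z
    using that unfolding minimizers_def is_arg_min_def min_value_def
    by (auto intro!: cInf_eq_minimum[symmetric] simp: not_less)
  then show "z \<in> minimizers X P \<Longrightarrow> z \<in> X \<and> P z = Pmin" .
  obtain z where z: "z \<in> minimizers X P" using min by blast
  show "x \<in> X \<Longrightarrow> Pmin \<le> P x"
    using *[OF z] z by (auto simp: minimizers_def is_arg_min_def not_less)
qed

text \<open>The error bound cannot be used at \<open>x\<close>, which may lie outside the sublevel
  set; it is used at the projection \<open>z\<close>. For a minimiser \<open>m\<close>, convexity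
  places a point of the segment from \<open>m\<close> to \<open>x\<close> in the sublevel set, which
  bounds the distance from \<open>x\<close> to \<open>z\<close> by \<open>(E - eps) / eps\<close>
  times that from \<open>z\<close> to \<open>m\<close>. The error bound at \<open>z\<close> gives a
  right-hand side linear in \<open>e\<close>; this is what the lower bound on \<open>Rx1\<close> is
  made for.\<close>

lemma near_sublevel_point:
  assumes e: "0 < eps" "0 \<le> e" "0 < c" "0 < \<theta>"
    and eb: "\<And>x. x \<in> opt_sublevel X P eps \<Longrightarrow> infdist x (minimizers X P) \<le> c * (P x - Pmin) powr \<theta>"
    and x: "x \<in> X" "P x - Pmin \<le> e + eps"
  shows "\<exists>z\<in>X. P z - Pmin \<le> eps \<and> norm (x - z) \<le> c * e / eps powr (1 - \<theta>)"
proof (cases "P x - Pmin \<le> eps")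
  case True
  then show ?thesis using x e by (intro bexI[of _ x]) auto
next
  case False
  define E where "E = P x - Pmin"
  have E: "eps < E" "E \<le> e + eps" using False x by (auto simp: E_def)
  let ?S = "opt_sublevel X P eps"
  obtain z0 where z0: "z0 \<in> minimizers X P" using min by blast
  have "?S = {x\<in>X. P x \<le> Pmin + eps}" by (auto simp: opt_sublevel_def)
  then have cl: "closed ?S" using closed_primal_sublevel by simp
  have "z0 \<in> ?S" using Pmin_attained[OF z0] e by (simp add: opt_sublevel_def)
  then have z_in: "closest_point ?S x \<in> ?S" by (intro closest_point_in_set cl) auto
  define z where "z = closest_point ?S x"
  define a where "a = norm (x - z)"
  have zS: "z \<in> X" "P z - Pmin \<le> eps" using z_in by (auto simp: z_def opt_sublevel_def)
  have key: "a * eps / (E - eps) \<le> dist z m" if m: "m \<in> minimizers X P" for m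
  proof -
    have mX: "m \<in> X" "P m = Pmin" using Pmin_attained[OF m] by auto
    \<comment> \<open>With this fraction, convexity bounds the gap at \<open>?u\<close> by exactly
      \<open>eps\<close>.\<close>
    define t where "t = eps / E"
    have t: "0 \<le> t" "t \<le> 1" using E e by (auto simp: t_def)
    let ?u = "(1 - t) *\<^sub>R m + t *\<^sub>R x"
    have "P ?u \<le> (1 - t) * Pmin + t * P x"
      using primal_segment[OF x(1) mX(1) t] mX by simp
    also have "\<dots> = Pmin + t * E" by (simp add: E_def algebra_simps)
    also have "t * E = eps" using E e by (simp add: t_def)
    finally have "?u \<in> ?S"
      using X(2) x mX t by (auto simp: opt_sublevel_def intro!: convexD)
    then have "a \<le> norm (x - ?u)"
      using closest_point_le[OF cl] by (simp add: a_def z_def dist_norm)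
    also have "x - ?u = (1 - t) *\<^sub>R (x - m)" by (simp add: algebra_simps)
    also have "norm \<dots> = (1 - t) * norm (x - m)" using t by simp
    also have "\<dots> \<le> (1 - t) * (a + dist z m)"
      using t norm_triangle_ineq[of "x - z" "z - m"]
      by (intro mult_left_mono) (auto simp: a_def dist_norm)
    finally have "t * a \<le> (1 - t) * dist z m" by (simp add: algebra_simps)
    then have "E * (t * a) \<le> E * ((1 - t) * dist z m)" using E e by (intro mult_left_mono) auto
    moreover have "E * t = eps" using E e by (simp add: t_def)
    moreover have "E * ((1 - t) * dist z m) = (E - E * t) * dist z m" by (simp add: algebra_simps)
    ultimately have "eps * a \<le> (E - eps) * dist z m" by (metis mult.assoc)
    then show ?thesis using E by (simp add: field_simps)
  qed
  have "a * eps / (E - eps) \<le> infdist z (minimizers X P)"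
    unfolding infdist_notempty[OF min] by (intro cINF_greatest min key)
  also have "\<dots> \<le> c * (P z - Pmin) powr \<theta>" using eb z_in by (simp add: z_def)
  also have "\<dots> \<le> c * eps powr \<theta>"
    using e zS Pmin_le[OF zS(1)] by (intro mult_left_mono powr_mono2) auto
  finally have "a * eps \<le> (E - eps) * (c * eps powr \<theta>)" using E by (simp add: field_simps)
  also have "\<dots> \<le> e * (c * eps powr \<theta>)" using E e by (intro mult_right_mono) auto
  finally have "a * eps \<le> c * e * eps powr \<theta>" by (simp add: algebra_simps)
  moreover have "eps powr \<theta> * eps powr (1 - \<theta>) = eps"
    using e by (simp add: powr_add[symmetric])
  ultimately have "a * eps powr (1 - \<theta>) * eps powr \<theta> \<le> c * e * eps powr \<theta>"
    by (simp add: algebra_simps)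
  then have "a \<le> c * e / eps powr (1 - \<theta>)" using e by (simp add: field_simps)
  then show ?thesis using zS by (intro bexI[of _ z]) (auto simp: a_def)
qed

end

subsection \<open>One stage of the algorithm\<close>

locale stochastic_saddle =
  saddle_problem Y phis phi p lam v L X l g G + prob_space \<Omega>
  for Y :: "'b::euclidean_space set" and phis phi p lam v L
    and X :: "'a::euclidean_space set" and l g G and \<Omega> :: "'w measure" +
  fixes Z :: "'z measure" and gx :: "'a \<Rightarrow> 'b \<Rightarrow> 'z \<Rightarrow> 'a" and gy :: "'a \<Rightarrow> 'b \<Rightarrow> 'z \<Rightarrow> 'b" and M B :: real
  assumes Y: "closed Y" "convex Y"
    and meas: "(\<lambda>((x, y), z). gx x y z) \<in> borel_measurable (restrict_space borel (X \<times> Y) \<Otimes>\<^sub>M Z)"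
      "(\<lambda>((x, y), z). gy x y z) \<in> borel_measurable (restrict_space borel (X \<times> Y) \<Otimes>\<^sub>M Z)"
    and MB: "0 < M" "0 < B"
    and bound_x: "\<And>x y z. x \<in> X \<Longrightarrow> y \<in> Y \<Longrightarrow> z \<in> space Z \<Longrightarrow> norm (gx x y z) \<le> M"
    and bound_y: "\<And>x y z. x \<in> X \<Longrightarrow> y \<in> Y \<Longrightarrow> z \<in> space Z \<Longrightarrow> norm (gy x y z) \<le> B"
begin

lemma oracle_measurable:
  assumes "(\<lambda>q. (a q, b q)) \<in> measurable Q (restrict_space borel (X \<times> Y))" "\<zeta> \<in> measurable Q Z"
  shows "(\<lambda>q. gx (a q) (b q) (\<zeta> q)) \<in> borel_measurable Q"
    and "(\<lambda>q. gy (a q) (b q) (\<zeta> q)) \<in> borel_measurable Q"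
  using measurable_compose[OF measurable_Pair[OF assms] meas(1)]
    measurable_compose[OF measurable_Pair[OF assms] meas(2)] by simp_all

lemma oracle_measurable_fixed:
  assumes "x \<in> X" "y \<in> Y" "\<zeta> \<in> measurable Q Z"
  shows "(\<lambda>q. gx x y (\<zeta> q)) \<in> borel_measurable Q" "(\<lambda>q. gy x y (\<zeta> q)) \<in> borel_measurable Q"
  using assms by (intro oracle_measurable measurable_const; simp add: space_restrict_space)+

lemma oracle_integrable:
  assumes "x \<in> X" "y \<in> Y" "\<zeta> \<in> measurable \<Omega> Z"
  shows "integrable \<Omega> (\<lambda>\<omega>. gx x y (\<zeta> \<omega>))" "integrable \<Omega> (\<lambda>\<omega>. gy x y (\<zeta> \<omega>))"
  using bound_x[OF assms(1,2)] bound_y[OF assms(1,2)] measurable_space[OF assms(3)]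
  by (auto intro!: integrable_const_bound oracle_measurable_fixed assms)

lemma norm_mean_oracle_le:
  assumes "x \<in> X" "y \<in> Y" "\<zeta> \<in> measurable \<Omega> Z"
  shows "norm (expectation (\<lambda>\<omega>. gx x y (\<zeta> \<omega>))) \<le> M" "norm (expectation (\<lambda>\<omega>. gy x y (\<zeta> \<omega>))) \<le> B"
proof -
  have "norm (expectation (\<lambda>\<omega>. gx x y (\<zeta> \<omega>))) \<le> expectation (\<lambda>\<omega>. norm (gx x y (\<zeta> \<omega>)))"
    by (rule integral_norm_bound)
  also have "\<dots> \<le> M"
    using bound_x[OF assms(1,2)] measurable_space[OF assms(3)]
    by (intro integral_le_const integrable_norm oracle_integrable assms) auto
  finally show "norm (expectation (\<lambda>\<omega>. gx x y (\<zeta> \<omega>))) \<le> M" .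
  have "norm (expectation (\<lambda>\<omega>. gy x y (\<zeta> \<omega>))) \<le> expectation (\<lambda>\<omega>. norm (gy x y (\<zeta> \<omega>)))"
    by (rule integral_norm_bound)
  also have "\<dots> \<le> B"
    using bound_y[OF assms(1,2)] measurable_space[OF assms(3)]
    by (intro integral_le_const integrable_norm oracle_integrable assms) auto
  finally show "norm (expectation (\<lambda>\<omega>. gy x y (\<zeta> \<omega>))) \<le> B" .
qed

lemma mean_oracle_measurable:
  assumes ab: "(\<lambda>q. (a q, b q)) \<in> measurable Q (restrict_space borel (X \<times> Y))" and z: "\<zeta> \<in> measurable \<Omega> Z"
  shows "(\<lambda>q. expectation (\<lambda>\<omega>. gx (a q) (b q) (\<zeta> \<omega>))) \<in> borel_measurable Q"
    and "(\<lambda>q. expectation (\<lambda>\<omega>. gy (a q) (b q) (\<zeta> \<omega>))) \<in> borel_measurable Q"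
proof -
  have ab': "(\<lambda>p. (a (fst p), b (fst p))) \<in> measurable (Q \<Otimes>\<^sub>M \<Omega>) (restrict_space borel (X \<times> Y))"
    by (rule measurable_compose[OF measurable_fst ab])
  have z': "(\<lambda>p. \<zeta> (snd p)) \<in> measurable (Q \<Otimes>\<^sub>M \<Omega>) Z"
    by (rule measurable_compose[OF measurable_snd z])
  show "(\<lambda>q. expectation (\<lambda>\<omega>. gx (a q) (b q) (\<zeta> \<omega>))) \<in> borel_measurable Q"
    using oracle_measurable(1)[OF ab' z'] by (intro borel_measurable_lebesgue_integral) (simp add: case_prod_beta')
  show "(\<lambda>q. expectation (\<lambda>\<omega>. gy (a q) (b q) (\<zeta> \<omega>))) \<in> borel_measurable Q"
    using oracle_measurable(2)[OF ab' z'] by (intro borel_measurable_lebesgue_integral) (simp add: case_prod_beta')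
qed

end

section \<open>Regret and noise of a stage with fixed start point\<close>

text \<open>Both \<open>x0\<close> and \<open>xd\<close> are constants here; the randomness of the
  start point is added later by \<open>potential_drift\<close>. In \<open>T2\<close> and
  \<open>T4\<close> the squared factor is the dual radius.\<close>

locale rspd_stage = stochastic_saddle Y phis phi p lam v L X l g G \<Omega> Z gx gy M B
  for Y :: "'b::euclidean_space set" and phis phi p lam v L
    and X :: "'a::euclidean_space set" and l g G and \<Omega> :: "'w measure"
    and Z :: "'z measure" and gx gy M B +
  fixes zeta :: "nat \<Rightarrow> 'w \<Rightarrow> 'z" and T :: nat and x0 xd :: 'a and Rx e dt :: real
  assumes indep: "indep_vars (\<lambda>_. Z) zeta {..<T}"
    and unbiased_x: "\<And>t x y. t < T \<Longrightarrow> x \<in> X \<Longrightarrow> y \<in> Y \<Longrightarrow>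
      subgradient_on X (\<lambda>x'. f x' y) x (expectation (\<lambda>\<omega>. gx x y (zeta t \<omega>)))"
    and unbiased_y: "\<And>t x y. t < T \<Longrightarrow> x \<in> X \<Longrightarrow> y \<in> Y \<Longrightarrow>
      supergradient_on Y (\<lambda>y'. f x y') y (expectation (\<lambda>\<omega>. gy x y (zeta t \<omega>)))"
    and x0: "x0 \<in> X" and xd: "xd \<in> X" "norm (x0 - xd) \<le> Rx"
    and Rx: "0 < Rx" and e: "0 < e" and dt: "0 < dt" "dt < 1"
    and T1: "320 * M\<^sup>2 * Rx\<^sup>2 / e\<^sup>2 \<le> real T"
    and T2: "320 * B\<^sup>2 * (L * G powr v * Rx powr v)\<^sup>2 / e\<^sup>2 \<le> real T"
    and T3: "8192 * ln (1 / dt) * M\<^sup>2 * Rx\<^sup>2 / e\<^sup>2 \<le> real T"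
    and T4: "8192 * ln (1 / dt) * B\<^sup>2 * (L * G powr v * Rx powr v)\<^sup>2 / e\<^sup>2 \<le> real T"
begin

definition Ry where "Ry = L * G powr v * Rx powr v"
definition etax where "etax = e / (40 * M\<^sup>2)"
definition etay where "etay = e / (40 * B\<^sup>2)"
definition Bx where "Bx = {x'\<in>X. norm (x' - x0) \<le> Rx}"
definition By where "By = {y'\<in>Y. norm (y' - A x0) \<le> Ry}"
definition hx where "hx t x y = expectation (\<lambda>\<omega>. gx x y (zeta t \<omega>))"
definition hy where "hy t x y = expectation (\<lambda>\<omega>. gy x y (zeta t \<omega>))"

text \<open>The third component is the ghost iterate: it is adapted to the samples, while the comparison
  point \<open>A (xbar \<omega>)\<close> of the dual player is not, so that only the differences between ghost and
  dual iterate enter the martingale \<open>noise\<close>.\<close>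

fun step where
  "step t (x, y, q) z =
    (closest_point Bx (x - etax *\<^sub>R gx x y z),
     closest_point By (y - etay *\<^sub>R (- gy x y z)),
     closest_point By (q - etay *\<^sub>R (gy x y z - hy t x y)))"

primrec chain where
  "chain 0 \<omega> = (x0, A x0, A x0)"
| "chain (Suc t) \<omega> = step t (chain t \<omega>) (zeta t \<omega>)"

fun noise where
  "noise t (x, y, q) z = (hx t x y - gx x y z) \<bullet> (x - xd) + (hy t x y - gy x y z) \<bullet> (q - y)"

definition xt where "xt t \<omega> = fst (chain t \<omega>)"
definition yt where "yt t \<omega> = fst (snd (chain t \<omega>))"
definition qt where "qt t \<omega> = snd (snd (chain t \<omega>))"

definition xbar where "xbar \<omega> = (1 / real T) *\<^sub>R (\<Sum>t<T. xt t \<omega>)"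

lemma Ry_nonneg: "0 \<le> Ry"
  unfolding Ry_def using L_pos by simp

lemma eta_pos: "0 < etax" "0 < etay"
  using e MB by (auto simp: etax_def etay_def)

lemma T_pos: "0 < T"
proof -
  have "0 < 320 * M\<^sup>2 * Rx\<^sup>2 / e\<^sup>2" using MB Rx e by simp
  then show ?thesis using T1 by linarith
qed

lemma balls: "convex Bx" "closed Bx" "x0 \<in> Bx" "convex By" "closed By" "A x0 \<in> By"
  unfolding Bx_def By_def using x0 Rx Ry_nonneg dual_map_in
  by (auto intro!: convex_ball_slice closed_ball_slice X Y)

lemma stage_iterates_eq:
  "stage_iterates X Y gx gy x0 (A x0) Rx Ry etax etay (\<lambda>t. zeta t \<omega>) t = (xt t \<omega>, yt t \<omega>)"
proof (induction t)
  case 0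
  then show ?case by (simp add: xt_def yt_def)
next
  case (Suc t)
  obtain x y q where "chain t \<omega> = (x, y, q)" by (cases "chain t \<omega>")
  then show ?case using Suc by (simp add: xt_def yt_def Bx_def By_def)
qed

lemma projection_in: "closest_point Bx w \<in> Bx" "closest_point By u \<in> By"
  using closest_point_in_set[OF balls(2)] closest_point_in_set[OF balls(5)] balls(3,6) by blast+

lemma chain_in: "chain t \<omega> \<in> Bx \<times> By \<times> By"
proof (cases t)
  case 0
  then show ?thesis using balls by simp
next
  case (Suc k)
  obtain x y q where "chain k \<omega> = (x, y, q)" by (cases "chain k \<omega>")
  then show ?thesis using Suc projection_in by simp
qed

lemma iterates_in: "xt t \<omega> \<in> Bx" "yt t \<omega> \<in> By" "qt t \<omega> \<in> By"
  using chain_in[of t \<omega>] by (auto simp: xt_def yt_def qt_def)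

lemma ball_subset: "x \<in> Bx \<Longrightarrow> x \<in> X" "y \<in> By \<Longrightarrow> y \<in> Y"
  by (auto simp: Bx_def By_def)

lemma chain_eq: "chain t \<omega> = (xt t \<omega>, yt t \<omega>, qt t \<omega>)"
  by (simp add: xt_def yt_def qt_def)

lemma iterates_Suc:
  "xt (Suc t) \<omega> = closest_point Bx (xt t \<omega> - etax *\<^sub>R gx (xt t \<omega>) (yt t \<omega>) (zeta t \<omega>))"
  "yt (Suc t) \<omega> = closest_point By (yt t \<omega> - etay *\<^sub>R (- gy (xt t \<omega>) (yt t \<omega>) (zeta t \<omega>)))"
  "qt (Suc t) \<omega> = closest_point By (qt t \<omega> - etay *\<^sub>R (gy (xt t \<omega>) (yt t \<omega>) (zeta t \<omega>) - hy t (xt t \<omega>) (yt t \<omega>)))"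
  using chain_eq[of "Suc t" \<omega>] unfolding chain.simps(2) chain_eq[of t \<omega>] step.simps prod.inject by simp_all

lemma sample_in: "t < T \<Longrightarrow> zeta t \<in> measurable \<Omega> Z"
  using indep by (auto simp: indep_vars_def)

lemma ball_diff_le:
  "x \<in> Bx \<Longrightarrow> x' \<in> Bx \<Longrightarrow> norm (x - x') \<le> 2 * Rx"
  "y \<in> By \<Longrightarrow> y' \<in> By \<Longrightarrow> norm (y - y') \<le> 2 * Ry"
  using norm_triangle_ineq4[of "x - x0" "x' - x0"] norm_triangle_ineq4[of "y - A x0" "y' - A x0"]
  by (auto simp: Bx_def By_def)

lemma oracle_deviation_le:
  assumes "t < T" "x \<in> X" "y \<in> Y" "z \<in> space Z"
  shows "norm (hx t x y - gx x y z) \<le> 2 * M" "norm (hy t x y - gy x y z) \<le> 2 * B"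
  using norm_triangle_ineq4[of "hx t x y" "gx x y z"] norm_triangle_ineq4[of "hy t x y" "gy x y z"]
    norm_mean_oracle_le[OF assms(2,3) sample_in[OF assms(1)]] bound_x[OF assms(2-4)] bound_y[OF assms(2-4)]
  by (auto simp: hx_def hy_def)

lemma xd_in: "xd \<in> Bx"
  using xd by (simp add: Bx_def norm_minus_commute)

lemma noise_bound:
  assumes t: "t < T" and w: "w \<in> Bx \<times> By \<times> By" and z: "z \<in> space Z"
  shows "\<bar>noise t w z\<bar> \<le> 4 * (M * Rx + B * Ry)"
proof -
  obtain x y q where w_eq: "w = (x, y, q)" and m: "x \<in> Bx" "y \<in> By" "q \<in> By" using w by auto
  have dev: "norm (hx t x y - gx x y z) \<le> 2 * M" "norm (hy t x y - gy x y z) \<le> 2 * B"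
    using oracle_deviation_le[OF t _ _ z] m ball_subset by auto
  have "\<bar>(hx t x y - gx x y z) \<bullet> (x - xd)\<bar> \<le> norm (hx t x y - gx x y z) * norm (x - xd)"
    by (rule Cauchy_Schwarz_ineq2)
  also have "\<dots> \<le> 2 * M * (2 * Rx)"
    using dev ball_diff_le(1)[OF m(1) xd_in] MB by (intro mult_mono) auto
  finally have 1: "\<bar>(hx t x y - gx x y z) \<bullet> (x - xd)\<bar> \<le> 2 * M * (2 * Rx)" .
  have "\<bar>(hy t x y - gy x y z) \<bullet> (q - y)\<bar> \<le> norm (hy t x y - gy x y z) * norm (q - y)"
    by (rule Cauchy_Schwarz_ineq2)
  also have "\<dots> \<le> 2 * B * (2 * Ry)"
    using dev ball_diff_le(2)[OF m(3,2)] MB by (intro mult_mono) auto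
  finally show ?thesis using 1 by (simp add: w_eq algebra_simps)
qed

lemma noise_mean:
  assumes t: "t < T" and w: "w \<in> Bx \<times> By \<times> By"
  shows "expectation (\<lambda>\<omega>. noise t w (zeta t \<omega>)) = 0"
proof -
  obtain x y q where w_eq: "w = (x, y, q)" and m: "x \<in> X" "y \<in> Y" using w ball_subset by auto
  note int = oracle_integrable[OF m sample_in[OF t]]
  have "expectation (\<lambda>\<omega>. (hx t x y - gx x y (zeta t \<omega>)) \<bullet> (x - xd)) = (hx t x y - hx t x y) \<bullet> (x - xd)"
    using int by (subst integral_inner_left) (auto simp: hx_def prob_space)
  moreover have "expectation (\<lambda>\<omega>. (hy t x y - gy x y (zeta t \<omega>)) \<bullet> (q - y)) = (hy t x y - hy t x y) \<bullet> (q - y)"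
    using int by (subst integral_inner_left) (auto simp: hy_def prob_space)
  ultimately show ?thesis
    using int by (simp add: w_eq)
qed

text \<open>On this restricted space \<open>noise_bound\<close> holds at every state, as
  \<open>chain_azuma\<close> demands, and the first two components lie in
  \<open>X \<times> Y\<close>, where the oracles are measurable.\<close>

abbreviation N where "N \<equiv> restrict_space borel (Bx \<times> By \<times> By)"

lemma state_measurable:
  "(\<lambda>q. (fst (fst q), fst (snd (fst q)))) \<in> measurable (N \<Otimes>\<^sub>M Z) (restrict_space borel (X \<times> Y))"
  "(\<lambda>q. fst (fst q)) \<in> borel_measurable (N \<Otimes>\<^sub>M Z)" "(\<lambda>q. fst (snd (fst q))) \<in> borel_measurable (N \<Otimes>\<^sub>M Z)"
  "(\<lambda>q. snd (snd (fst q))) \<in> borel_measurable (N \<Otimes>\<^sub>M Z)"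
proof -
  have pm: "(\<lambda>w. fst w) \<in> borel_measurable N" "(\<lambda>w. fst (snd w)) \<in> borel_measurable N" "(\<lambda>w. snd (snd w)) \<in> borel_measurable N"
    by (intro measurable_restrict_space1 borel_measurable_continuous_onI continuous_intros)+
  have m: "(\<lambda>w. (fst w, fst (snd w))) \<in> measurable N (restrict_space borel (X \<times> Y))"
    using ball_subset by (intro measurable_restrict_space2 borel_measurable_Pair pm) (auto simp: space_restrict_space)
  show "(\<lambda>q. (fst (fst q), fst (snd (fst q)))) \<in> measurable (N \<Otimes>\<^sub>M Z) (restrict_space borel (X \<times> Y))"
    by (rule measurable_compose[OF measurable_fst m])
  show "(\<lambda>q. fst (fst q)) \<in> borel_measurable (N \<Otimes>\<^sub>M Z)" "(\<lambda>q. fst (snd (fst q))) \<in> borel_measurable (N \<Otimes>\<^sub>M Z)"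
    "(\<lambda>q. snd (snd (fst q))) \<in> borel_measurable (N \<Otimes>\<^sub>M Z)"
    by (rule measurable_compose[OF measurable_fst pm(1)] measurable_compose[OF measurable_fst pm(2)]
        measurable_compose[OF measurable_fst pm(3)])+
qed

lemmas oracles_measurable =
  oracle_measurable[OF state_measurable(1) measurable_snd]
  mean_oracle_measurable[OF state_measurable(1) sample_in, folded hx_def]
  mean_oracle_measurable[OF state_measurable(1) sample_in, folded hy_def]

lemma step_measurable:
  assumes t: "t < T"
  shows "(\<lambda>(w, z). step t w z) \<in> measurable (N \<Otimes>\<^sub>M Z) N"
proof -
  have cp: "(\<lambda>q. closest_point Bx (w q)) \<in> borel_measurable (N \<Otimes>\<^sub>M Z)"
    if "w \<in> borel_measurable (N \<Otimes>\<^sub>M Z)" for w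
    by (rule borel_measurable_continuous_on[OF continuous_on_closest_point that]) (use balls in auto)
  have cp': "(\<lambda>q. closest_point By (w q)) \<in> borel_measurable (N \<Otimes>\<^sub>M Z)"
    if "w \<in> borel_measurable (N \<Otimes>\<^sub>M Z)" for w
    by (rule borel_measurable_continuous_on[OF continuous_on_closest_point that]) (use balls in auto)
  have eq: "(\<lambda>(w, z). step t w z) = (\<lambda>q.
      (closest_point Bx (fst (fst q) - etax *\<^sub>R gx (fst (fst q)) (fst (snd (fst q))) (snd q)),
       closest_point By (fst (snd (fst q)) - etay *\<^sub>R (- gy (fst (fst q)) (fst (snd (fst q))) (snd q))),
       closest_point By (snd (snd (fst q)) - etay *\<^sub>R (gy (fst (fst q)) (fst (snd (fst q))) (snd q)
         - hy t (fst (fst q)) (fst (snd (fst q)))))))"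
    by (auto simp: fun_eq_iff)
  show ?thesis
    unfolding eq
    by (intro measurable_restrict_space2 borel_measurable_Pair cp cp' borel_measurable_diff borel_measurable_scaleR
        borel_measurable_uminus borel_measurable_const state_measurable oracles_measurable t)
      (auto intro: projection_in)
qed

lemma noise_measurable:
  assumes t: "t < T"
  shows "(\<lambda>(w, z). noise t w z) \<in> borel_measurable (N \<Otimes>\<^sub>M Z)"
proof -
  have eq: "(\<lambda>(w, z). noise t w z) = (\<lambda>q.
      (hx t (fst (fst q)) (fst (snd (fst q))) - gx (fst (fst q)) (fst (snd (fst q))) (snd q)) \<bullet> (fst (fst q) - xd)
      + (hy t (fst (fst q)) (fst (snd (fst q))) - gy (fst (fst q)) (fst (snd (fst q))) (snd q))
          \<bullet> (snd (snd (fst q)) - fst (snd (fst q))))"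
    by (auto simp: fun_eq_iff)
  show ?thesis
    unfolding eq
    by (intro borel_measurable_add borel_measurable_inner borel_measurable_diff borel_measurable_const
        state_measurable oracles_measurable t)
qed

text \<open>At the threshold \<open>real T * e / 8\<close> the exponent of Azuma's inequality is
  \<open>real T * e\<^sup>2 / (128 * ?K\<^sup>2)\<close>. Since \<open>?K\<^sup>2\<close> is at most
  32 times the sum of the squares of \<open>M * Rx\<close> and \<open>B * Ry\<close>, the factor
  4096 = 128 * 32 arises. \<open>T3\<close> and \<open>T4\<close> each pay for one of the two
  squares, whence 8192.\<close>

lemma noise_tail:
  defines "Dev \<equiv> {\<omega>\<in>space \<Omega>. real T * e / 8 \<le> (\<Sum>t<T. noise t (chain t \<omega>) (zeta t \<omega>))}"
  shows "Dev \<in> events" "prob Dev \<le> dt"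
proof -
  let ?K = "4 * (M * Rx + B * Ry)"
  have K: "0 < ?K" using MB Rx Ry_nonneg by (simp add: add_pos_nonneg)
  have sp: "space N = Bx \<times> By \<times> By" by (simp add: space_restrict_space)
  have az: "Dev \<in> events" "prob Dev \<le> exp (- (real T * e / 8)\<^sup>2 / (2 * real T * ?K\<^sup>2))"
    unfolding Dev_def
    by (rule chain_azuma[where N = N and Z = Z and F = step and ?w0.0 = "(x0, A x0, A x0)"];
        use indep balls step_measurable noise_measurable noise_bound noise_mean T_pos K e sp in simp)+
  show "Dev \<in> events" by (rule az)
  have e2: "0 < e\<^sup>2" using e by simp
  have lnp: "0 < ln (1 / dt)" using dt by simp
  have "8192 * ln (1 / dt) * (M * Rx)\<^sup>2 \<le> real T * e\<^sup>2" "8192 * ln (1 / dt) * (B * Ry)\<^sup>2 \<le> real T * e\<^sup>2"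
    using T3 T4 e2 unfolding Ry_def[symmetric] by (simp_all add: pos_divide_le_eq power_mult_distrib mult.assoc)
  then have "4096 * ln (1 / dt) * ((M * Rx)\<^sup>2 + (B * Ry)\<^sup>2) \<le> real T * e\<^sup>2"
    by (simp add: algebra_simps)
  moreover have "128 * ln (1 / dt) * ?K\<^sup>2 \<le> 4096 * ln (1 / dt) * ((M * Rx)\<^sup>2 + (B * Ry)\<^sup>2)"
  proof -
    have "?K\<^sup>2 \<le> 32 * ((M * Rx)\<^sup>2 + (B * Ry)\<^sup>2)"
      using zero_le_power2[of "M * Rx - B * Ry"] by (simp add: power2_eq_square algebra_simps)
    from mult_left_mono[OF this, of "128 * ln (1 / dt)"] show ?thesis using lnp by simp
  qed
  ultimately have "128 * ln (1 / dt) * ?K\<^sup>2 \<le> real T * e\<^sup>2" by linarith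
  then have "ln (1 / dt) \<le> real T * e\<^sup>2 / (128 * ?K\<^sup>2)" using K by (simp add: field_simps)
  also have "\<dots> = (real T * e / 8)\<^sup>2 / (2 * real T * ?K\<^sup>2)"
    using T_pos by (simp add: power_mult_distrib power_divide power2_eq_square)
  finally have "exp (- (real T * e / 8)\<^sup>2 / (2 * real T * ?K\<^sup>2)) \<le> exp (- ln (1 / dt))" by simp
  also have "\<dots> = dt" using dt by (simp add: ln_div)
  finally show "prob Dev \<le> dt" using az by simp
qed

lemma xbar_in: "xbar \<omega> \<in> Bx"
proof -
  have "(\<Sum>t<T. (1 / real T) *\<^sub>R xt t \<omega>) \<in> Bx"
    using T_pos iterates_in by (intro convex_sum balls) auto
  then show ?thesis by (simp add: xbar_def scaleR_sum_right)
qed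

text \<open>This dictates the choice of \<open>Ry\<close>: the exact dual maximiser at the average
  must be an admissible comparison point for the two regrets on the dual ball.\<close>

lemma dual_xbar_in: "A (xbar \<omega>) \<in> By"
proof -
  have "norm (A (xbar \<omega>) - A x0) \<le> L * G powr v * norm (xbar \<omega> - x0) powr v"
    using ball_subset(1)[OF xbar_in] x0 by (intro dual_map_holder)
  also have "\<dots> \<le> Ry"
    unfolding Ry_def using xbar_in[of \<omega>] v_pos L_pos by (intro mult_left_mono powr_mono2) (auto simp: Bx_def)
  finally show ?thesis using dual_map_in by (simp add: By_def)
qed

text \<open>Replacing the mean \<open>hy\<close> by the sample \<open>gy\<close> leaves an error
  tested against \<open>y - b\<close>. Writing \<open>y - b\<close> as the difference of
  \<open>q - b\<close> and \<open>q - y\<close> separates it: the first part depends only on the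
  state and joins \<open>noise\<close>, the second is the regret of the ghost iterate for the
  directions \<open>gy - hy\<close>.\<close>

lemma regret_split:
  assumes \<omega>: "\<omega> \<in> space \<Omega>" and t: "t < T" and y: "y \<in> Y"
  defines "a \<equiv> xt t \<omega>" and "b \<equiv> yt t \<omega>" and "q \<equiv> qt t \<omega>" and "z \<equiv> zeta t \<omega>"
  shows "f a y - P xd \<le> gx a b z \<bullet> (a - xd) + (- gy a b z) \<bullet> (b - y)
    + (gy a b z - hy t a b) \<bullet> (q - y) + noise t (chain t \<omega>) z"
proof -
  have ab: "a \<in> X" "b \<in> Y" using iterates_in ball_subset by (auto simp: a_def b_def)
  have "f a b + hx t a b \<bullet> (xd - a) \<le> f xd b"
    using unbiased_x[OF t ab] xd by (simp add: subgradient_on_def hx_def)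
  moreover have "f a y \<le> f a b + hy t a b \<bullet> (y - b)"
    using unbiased_y[OF t ab] y by (simp add: supergradient_on_def hy_def)
  moreover have "f xd b \<le> P xd" by (rule saddle_le_primal[OF ab(2)])
  ultimately have "f a y - P xd \<le> hx t a b \<bullet> (a - xd) + hy t a b \<bullet> (y - b)"
    by (simp add: inner_diff_right)
  also have "\<dots> = gx a b z \<bullet> (a - xd) + (- gy a b z) \<bullet> (b - y)
    + (gy a b z - hy t a b) \<bullet> (q - y) + noise t (a, b, q) z"
    by (simp add: inner_diff_left inner_diff_right algebra_simps)
  finally show ?thesis by (simp add: chain_eq a_def b_def q_def)
qed

lemma stage_gap:
  assumes \<omega>: "\<omega> \<in> space \<Omega>"
  shows "real T * (P (xbar \<omega>) - P xd)
    \<le> (21 / 80) * (real T * e) + (\<Sum>t<T. noise t (chain t \<omega>) (zeta t \<omega>))"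
proof -
  let ?y = "A (xbar \<omega>)"
  define ga where "ga t = gx (xt t \<omega>) (yt t \<omega>) (zeta t \<omega>)" for t
  define gb where "gb t = gy (xt t \<omega>) (yt t \<omega>) (zeta t \<omega>)" for t
  have mem: "xt t \<omega> \<in> X" "yt t \<omega> \<in> Y" for t using iterates_in ball_subset by auto
  have zs: "zeta t \<omega> \<in> space Z" if "t < T" for t using measurable_space[OF sample_in[OF that] \<omega>] .
  have e2: "0 < e\<^sup>2" using e by simp
  have r1: "(\<Sum>t<T. ga t \<bullet> (xt t \<omega> - xd)) \<le> Rx\<^sup>2 / (2 * etax) + etax * M\<^sup>2 / 2 * real T"
    using bound_x[OF mem zs] xd
    by (intro projected_subgradient_regret[where w = "\<lambda>t. xt t \<omega>", OF balls(1,2) xd_in eta_pos(1)])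
      (auto simp: ga_def iterates_Suc(1) xt_def[of 0])
  have y0: "norm (A x0 - ?y) \<le> Ry"
    using dual_xbar_in[of \<omega>] by (simp add: By_def norm_minus_commute)
  have r2: "(\<Sum>t<T. (- gb t) \<bullet> (yt t \<omega> - ?y)) \<le> Ry\<^sup>2 / (2 * etay) + etay * B\<^sup>2 / 2 * real T"
    using bound_y[OF mem zs] y0
    by (intro projected_subgradient_regret[where w = "\<lambda>t. yt t \<omega>", OF balls(4,5) dual_xbar_in eta_pos(2)])
      (auto simp: gb_def iterates_Suc(2) yt_def[of 0])
  have r3: "(\<Sum>t<T. (gb t - hy t (xt t \<omega>) (yt t \<omega>)) \<bullet> (qt t \<omega> - ?y))
      \<le> Ry\<^sup>2 / (2 * etay) + etay * (2 * B)\<^sup>2 / 2 * real T"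
    using oracle_deviation_le(2)[OF _ mem zs] y0
    by (intro projected_subgradient_regret[where w = "\<lambda>t. qt t \<omega>", OF balls(4,5) dual_xbar_in eta_pos(2)])
      (auto simp: gb_def iterates_Suc(3) qt_def[of 0] norm_minus_commute)
  have "320 * (M\<^sup>2 * Rx\<^sup>2) \<le> real T * e\<^sup>2" "320 * (B\<^sup>2 * Ry\<^sup>2) \<le> real T * e\<^sup>2"
    using T1 T2 e2 unfolding Ry_def[symmetric] by (simp_all add: pos_divide_le_eq mult.assoc)
  \<comment> \<open>With the chosen step size the primal term equals
    \<open>20 * M\<^sup>2 * Rx\<^sup>2 / e\<close>, and 320 is 16 times 20; likewise for the dual
    term.\<close>
  then have a: "Rx\<^sup>2 / (2 * etax) \<le> real T * e / 16" "Ry\<^sup>2 / (2 * etay) \<le> real T * e / 16"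
    using e MB by (simp_all add: etax_def etay_def field_simps power2_eq_square)
  have b: "etax * M\<^sup>2 = e / 40" "etay * B\<^sup>2 = e / 40" "etay * (2 * B)\<^sup>2 = e / 10"
    using MB by (simp_all add: etax_def etay_def power_mult_distrib)
  have "real T * (P (xbar \<omega>) - P xd) = real T * f (xbar \<omega>) ?y - real T * P xd"
    by (simp add: primal_eq_saddle[of "xbar \<omega>"] right_diff_distrib)
  also have "\<dots> \<le> (\<Sum>t<T. f (xt t \<omega>) ?y) - real T * P xd"
    using saddle_average_le[OF T_pos mem(1) dual_map_in] by (simp add: xbar_def)
  also have "\<dots> = (\<Sum>t<T. f (xt t \<omega>) ?y - P xd)"
    by (simp add: sum_subtractf)
  also have "\<dots> \<le> (\<Sum>t<T. ga t \<bullet> (xt t \<omega> - xd) + (- gb t) \<bullet> (yt t \<omega> - ?y)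
      + (gb t - hy t (xt t \<omega>) (yt t \<omega>)) \<bullet> (qt t \<omega> - ?y) + noise t (chain t \<omega>) (zeta t \<omega>))"
    unfolding ga_def gb_def by (intro sum_mono regret_split \<omega> dual_map_in) simp
  \<comment> \<open>Relative to \<open>real T * e\<close>, the three radius terms contribute 1/16
    each and the step-size terms 1/80, 1/80 and 1/20. The last is four times larger because the
    ghost directions are bounded by \<open>2 * B\<close>.\<close>
  also have "\<dots> \<le> (21 / 80) * (real T * e) + (\<Sum>t<T. noise t (chain t \<omega>) (zeta t \<omega>))"
    using r1 r2 r3 a unfolding sum.distrib b by (simp add: algebra_simps)
  finally show ?thesis .
qed

text \<open>If the noise stays below its threshold, the gap is less than 21/80 + 10/80 of
  \<open>e\<close>, which is below \<open>e / 2\<close>; so failure forces the deviation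
  event.\<close>

lemma stage_failure: "measure \<Omega> {\<omega>\<in>space \<Omega>. P xd + e / 2 < P (xbar \<omega>)} \<le> dt"
proof -
  have "{\<omega>\<in>space \<Omega>. P xd + e / 2 < P (xbar \<omega>)}
      \<subseteq> {\<omega>\<in>space \<Omega>. real T * e / 8 \<le> (\<Sum>t<T. noise t (chain t \<omega>) (zeta t \<omega>))}"
  proof safe
    fix \<omega> assume \<omega>: "\<omega> \<in> space \<Omega>" and bad: "P xd + e / 2 < P (xbar \<omega>)"
    have "real T * (e / 2) < real T * (P (xbar \<omega>) - P xd)"
      using bad T_pos by (intro mult_strict_left_mono) auto
    with stage_gap[OF \<omega>] have "real T * (e / 2) < (21 / 80) * (real T * e) + (\<Sum>t<T. noise t (chain t \<omega>) (zeta t \<omega>))"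
      by linarith
    moreover have "0 < real T * e" using T_pos e by simp
    ultimately show "real T * e / 8 \<le> (\<Sum>t<T. noise t (chain t \<omega>) (zeta t \<omega>))"
      by linarith
  qed
  then show ?thesis
    using finite_measure_mono noise_tail by (meson order_trans)
qed

end

subsection \<open>All stages\<close>

text \<open>The second bound gives the final accuracy. The third says that every stage, even the
  last, is entered at a level above \<open>eps\<close>; the rate estimate relies on this.\<close>

lemma num_stages_bounds:
  assumes "0 < eps" "eps < eps0"
  shows "1 \<le> num_stages eps0 eps" "eps0 / 2 ^ num_stages eps0 eps \<le> eps"
    "eps < eps0 / 2 ^ (num_stages eps0 eps - 1)" "real (num_stages eps0 eps) < log 2 (eps0 / eps) + 1"
proof -
  let ?S = "num_stages eps0 eps"
  let ?r = "log 2 (eps0 / eps)"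
  have r: "0 < ?r" using assms by (simp add: zero_less_log_cancel_iff)
  then have S: "real ?S = of_int \<lceil>?r\<rceil>" by (simp add: num_stages_def)
  then have le: "?r \<le> real ?S" and lt: "real ?S < ?r + 1" by linarith+
  show S1: "1 \<le> ?S" using le r by linarith
  show "real ?S < ?r + 1" by (rule lt)
  have q: "2 powr ?r = eps0 / eps" using assms by simp
  have "2 powr ?r \<le> 2 powr real ?S" using le by simp
  then have "eps0 / eps \<le> 2 powr real ?S" by (simp only: q)
  then show "eps0 / 2 ^ ?S \<le> eps" using assms by (simp add: powr_realpow field_simps)
  have "2 powr real (?S - 1) < 2 powr ?r" using lt S1 by (simp add: of_nat_diff)
  then have "2 powr real (?S - 1) < eps0 / eps" by (simp only: q)
  then show "eps < eps0 / 2 ^ (?S - 1)" using assms by (simp add: powr_realpow field_simps)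
qed

text \<open>Powers with exponent \<open>2 * v\<close> become squares, which makes the dual radius
  visible. \<open>Suc s\<close> absorbs the shift between stages counted from 1 and halvings counted
  from 0.\<close>

lemma stage_requirement_le_iff:
  "stage_requirement M B L G v eps0 Rx1 dt (Suc s) \<le> b \<longleftrightarrow>
    320 * M\<^sup>2 * (Rx1 / 2 ^ s)\<^sup>2 / (eps0 / 2 ^ s)\<^sup>2 \<le> b
    \<and> 320 * B\<^sup>2 * (L * G powr v * (Rx1 / 2 ^ s) powr v)\<^sup>2 / (eps0 / 2 ^ s)\<^sup>2 \<le> b
    \<and> 8192 * ln (1 / dt) * M\<^sup>2 * (Rx1 / 2 ^ s)\<^sup>2 / (eps0 / 2 ^ s)\<^sup>2 \<le> b
    \<and> 8192 * ln (1 / dt) * B\<^sup>2 * (L * G powr v * (Rx1 / 2 ^ s) powr v)\<^sup>2 / (eps0 / 2 ^ s)\<^sup>2 \<le> b"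
proof -
  have sq: "a powr (2 * v) = (a powr v)\<^sup>2" for a :: real
    unfolding mult_2 powr_add power2_eq_square ..
  have Max4: "Max {x1, x2, x3, x4} \<le> b \<longleftrightarrow> x1 \<le> b \<and> x2 \<le> b \<and> x3 \<le> b \<and> x4 \<le> b" for x1 x2 x3 x4 :: real
    by simp
  show ?thesis
    unfolding stage_requirement_def Let_def
    by (simp only: Max4 sq power_mult_distrib mult.assoc diff_Suc_1)
qed

lemma stage_iterates_cong:
  "(\<And>i. i < t \<Longrightarrow> z i = z' i) \<Longrightarrow>
    stage_iterates X Y gx gy x0 y0 Rx Ry etax etay z t = stage_iterates X Y gx gy x0 y0 Rx Ry etax etay z' t"
  by (induction t) auto

section \<open>Measurability of a stage jointly in its start point and its samples\<close>

context stochastic_saddle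
begin

context
  fixes Q :: "'q measure" and ctr :: "'q \<Rightarrow> 'a" and z :: "'q \<Rightarrow> nat \<Rightarrow> 'z" and Rx Ry etax etay :: real
  assumes R: "0 \<le> Rx" "0 \<le> Ry"
    and ctr: "ctr \<in> measurable Q (restrict_space borel X)"
begin

text \<open>Unlike in \<open>step_measurable\<close>, the ball centres \<open>ctr q\<close> and
  \<open>A (ctr q)\<close> vary, so continuity of the projection in its centre and continuity of
  \<open>A\<close> are both called upon.\<close>

lemma stage_iterates_measurable:
  assumes z: "\<And>i. i < t \<Longrightarrow> (\<lambda>q. z q i) \<in> measurable Q Z"
  defines "it \<equiv> \<lambda>q. stage_iterates X Y gx gy (ctr q) (A (ctr q)) Rx Ry etax etay (z q) t"
  shows "(\<lambda>q. fst (it q)) \<in> measurable Q (restrict_space borel X)"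
    and "(\<lambda>q. snd (it q)) \<in> measurable Q (restrict_space borel Y)"
proof -
  have A: "(\<lambda>q. A (ctr q)) \<in> measurable Q (restrict_space borel Y)"
  proof (rule measurable_compose[OF ctr])
    show "A \<in> measurable (restrict_space borel X) (restrict_space borel Y)"
      using dual_map_in
      by (intro measurable_restrict_space2 borel_measurable_continuous_on_restrict continuous_on_dual_map) auto
  qed
  have "(\<lambda>q. fst (it q)) \<in> measurable Q (restrict_space borel X)
      \<and> (\<lambda>q. snd (it q)) \<in> measurable Q (restrict_space borel Y)"
    using z unfolding it_def
  proof (induction t)
    case 0
    then show ?case using ctr A by simp
  next
    case (Suc t)
    let ?it = "\<lambda>q. stage_iterates X Y gx gy (ctr q) (A (ctr q)) Rx Ry etax etay (z q) t"
    have x: "(\<lambda>q. fst (?it q)) \<in> measurable Q (restrict_space borel X)"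
      and y: "(\<lambda>q. snd (?it q)) \<in> measurable Q (restrict_space borel Y)"
      using Suc.IH Suc.prems by auto
    have xb: "(\<lambda>q. fst (?it q)) \<in> borel_measurable Q" and yb: "(\<lambda>q. snd (?it q)) \<in> borel_measurable Q"
      using x y by (simp_all add: measurable_restrict_space2_iff)
    have mem: "fst (?it q) \<in> X" "snd (?it q) \<in> Y" if "q \<in> space Q" for q
      using measurable_space[OF x that] measurable_space[OF y that] by (simp_all add: space_restrict_space)
    have xy: "(\<lambda>q. (fst (?it q), snd (?it q))) \<in> measurable Q (restrict_space borel (X \<times> Y))"
      by (intro measurable_restrict_space2 borel_measurable_Pair xb yb) (simp add: mem_Times_iff mem)
    note o = oracle_measurable[OF xy Suc.prems[OF lessI]]
    have "(\<lambda>q. closest_point {x'\<in>X. norm (x' - ctr q) \<le> Rx} (fst (?it q) - etax *\<^sub>R gx (fst (?it q)) (snd (?it q)) (z q t)))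
        \<in> measurable Q (restrict_space borel X)"
      by (rule closest_point_ball_slice_measurable[OF X R(1) ctr])
        (intro borel_measurable_diff borel_measurable_scaleR borel_measurable_const xb o)
    moreover have "(\<lambda>q. closest_point {y'\<in>Y. norm (y' - A (ctr q)) \<le> Ry} (snd (?it q) + etay *\<^sub>R gy (fst (?it q)) (snd (?it q)) (z q t)))
        \<in> measurable Q (restrict_space borel Y)"
      by (rule closest_point_ball_slice_measurable[OF Y R(2) A])
        (intro borel_measurable_add borel_measurable_scaleR borel_measurable_const yb o)
    ultimately show ?case by (simp add: case_prod_beta')
  qed
  then show "(\<lambda>q. fst (it q)) \<in> measurable Q (restrict_space borel X)"
    and "(\<lambda>q. snd (it q)) \<in> measurable Q (restrict_space borel Y)" by auto
qed

lemma stage_average_measurable: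
  assumes z: "\<And>i. i < T \<Longrightarrow> (\<lambda>q. z q i) \<in> measurable Q Z" and "0 < T"
  shows "(\<lambda>q. (1 / real T) *\<^sub>R (\<Sum>t<T. fst (stage_iterates X Y gx gy (ctr q) (A (ctr q)) Rx Ry etax etay (z q) t)))
    \<in> measurable Q (restrict_space borel X)"
proof -
  let ?x = "\<lambda>t q. fst (stage_iterates X Y gx gy (ctr q) (A (ctr q)) Rx Ry etax etay (z q) t)"
  have m: "?x t \<in> measurable Q (restrict_space borel X)" if "t < T" for t
    using that z by (intro stage_iterates_measurable) auto
  have "(\<lambda>q. (1 / real T) *\<^sub>R (\<Sum>t<T. ?x t q)) \<in> borel_measurable Q"
    using m by (intro borel_measurable_scaleR borel_measurable_const borel_measurable_sum)
      (auto simp: measurable_restrict_space2_iff)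
  moreover have "(1 / real T) *\<^sub>R (\<Sum>t<T. ?x t q) \<in> X" if "q \<in> space Q" for q
    using measurable_space[OF m that] \<open>0 < T\<close> by (intro average_in) (auto simp: space_restrict_space)
  ultimately show ?thesis by (intro measurable_restrict_space2) auto
qed

end

end

section \<open>Failure probability of the whole run\<close>

locale rspd_run = stochastic_saddle Y phis phi p lam v L X l g G \<Omega> Z gx gy M B
  for Y :: "'b::euclidean_space set" and phis phi p lam v L
    and X :: "'a::euclidean_space set" and l g G and \<Omega> :: "'w measure"
    and Z :: "'z measure" and gx gy M B +
  fixes \<xi> :: "nat \<Rightarrow> nat \<Rightarrow> 'w \<Rightarrow> 'z" and S T :: nat and x0 :: 'a and c \<theta> eps0 eps \<delta> Rx1 :: real
  assumes indep: "indep_vars (\<lambda>_. Z) (\<lambda>(s, t). \<xi> s t) ({1..S} \<times> {..<T})"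
    and unbiased_x: "\<And>s t x y. s \<in> {1..S} \<Longrightarrow> t < T \<Longrightarrow> x \<in> X \<Longrightarrow> y \<in> Y \<Longrightarrow>
      subgradient_on X (\<lambda>x'. f x' y) x (expectation (\<lambda>\<omega>. gx x y (\<xi> s t \<omega>)))"
    and unbiased_y: "\<And>s t x y. s \<in> {1..S} \<Longrightarrow> t < T \<Longrightarrow> x \<in> X \<Longrightarrow> y \<in> Y \<Longrightarrow>
      supergradient_on Y (\<lambda>y'. f x y') y (expectation (\<lambda>\<omega>. gy x y (\<xi> s t \<omega>)))"
    and eps: "0 < eps" "eps < eps0"
    and x0: "x0 \<in> X" "P x0 - Pmin \<le> eps0"
    and error_bound: "0 < c" "0 < \<theta>"
      "\<And>x. x \<in> opt_sublevel X P eps \<Longrightarrow> infdist x (minimizers X P) \<le> c * (P x - Pmin) powr \<theta>"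
    and \<delta>: "0 < \<delta>" "\<delta> < 1"
    and S: "S = num_stages eps0 eps"
    and Rx1: "c * eps0 / eps powr (1 - \<theta>) \<le> Rx1"
    and T: "\<And>s. s \<in> {1..S} \<Longrightarrow> stage_requirement M B L G v eps0 Rx1 (\<delta> / real S) s \<le> real T"
begin

text \<open>Indices start at 0: \<open>R s\<close> and \<open>e s\<close> are the radius and the
  accuracy level with which stage \<open>s + 1\<close> is entered.\<close>

definition R where "R s = Rx1 / 2 ^ s"
definition e where "e s = eps0 / 2 ^ s"
definition dt where "dt = \<delta> / real S"

definition stage where
  "stage s x z = (1 / real T) *\<^sub>R (\<Sum>t<T. fst (stage_iterates X Y gx gy x (A x)
     (R s) (L * G powr v * R s powr v) (e s / (40 * M\<^sup>2)) (e s / (40 * B\<^sup>2)) z t))"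

definition xs where
  "xs s \<omega> = fst (rspd_state X Y gx gy A M B L G v x0 T Rx1 eps0 (\<lambda>s t. \<xi> s t \<omega>) s)"

text \<open>Restriction to the row actually read turns it into a point of a finite product space,
  the sample space for the chain of start points.\<close>

definition samples where "samples s \<omega> = restrict (\<lambda>t. \<xi> (Suc s) t \<omega>) {..<T}"

lemma S_pos: "1 \<le> S" using num_stages_bounds[OF eps] S by simp

lemma Rx1_pos: "0 < Rx1"
proof -
  have "0 < c * eps0 / eps powr (1 - \<theta>)" using error_bound eps by simp
  then show ?thesis using Rx1 by linarith
qed

lemma R_pos: "0 < R s" and e_pos: "0 < e s"
  using Rx1_pos eps by (auto simp: R_def e_def)

lemma dt_bounds: "0 < dt" "dt < 1" "real S * dt = \<delta>"
proof -
  have "1 \<le> real S" using S_pos by simp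
  then show "0 < dt" "dt < 1" "real S * dt = \<delta>" using \<delta> by (auto simp: dt_def field_simps)
qed

lemma rspd_state_eq:
  "rspd_state X Y gx gy A M B L G v x0 T Rx1 eps0 (\<lambda>s t. \<xi> s t \<omega>) s
    = (xs s \<omega>, R s, L * G powr v * R s powr v, e s / (40 * M\<^sup>2), e s / (40 * B\<^sup>2))"
proof (induction s)
  case 0
  then show ?case by (simp add: xs_def R_def e_def)
next
  case (Suc s)
  have R: "R (Suc s) = R s / 2" by (simp add: R_def)
  have "R (Suc s) powr v = R s powr v / 2 powr v"
    unfolding R using R_pos[of s] by (simp add: powr_divide)
  moreover have "e (Suc s) / (40 * K) = e s / (40 * K) / 2" for K by (simp add: e_def)
  ultimately show ?case
    by (simp add: xs_def[of "Suc s"] Suc R)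
qed

lemma xs_Suc: "xs (Suc s) \<omega> = stage s (xs s \<omega>) (samples s \<omega>)"
proof -
  have "xs (Suc s) \<omega> = stage s (xs s \<omega>) (\<lambda>t. \<xi> (Suc s) t \<omega>)"
    by (simp add: xs_def[of "Suc s"] rspd_state_eq stage_def)
  also have "\<dots> = stage s (xs s \<omega>) (samples s \<omega>)"
    unfolding stage_def by (intro arg_cong2[where f = scaleR] sum.cong refl arg_cong[where f = fst] stage_iterates_cong)
      (auto simp: samples_def)
  finally show ?thesis .
qed

lemma xs_0: "xs 0 \<omega> = x0"
  by (simp add: xs_def)

lemma indep_stage:
  assumes "s \<in> {1..S}"
  shows "indep_vars (\<lambda>_. Z) (\<xi> s) {..<T}"
proof -
  have "indep_vars (\<lambda>j. PiM {(s, j)} (\<lambda>_. Z)) (\<lambda>j \<omega>. restrict (\<lambda>i. (case i of (s, t) \<Rightarrow> \<xi> s t) \<omega>) {(s, j)}) {..<T}"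
    using assms by (intro indep_vars_restrict[OF indep]) (auto simp: disjoint_family_on_def)
  from indep_vars_compose2[OF this, of "\<lambda>j r. r (s, j)" "\<lambda>_. Z"]
  show ?thesis by simp
qed

lemma indep_samples: "indep_vars (\<lambda>_. PiM {..<T} (\<lambda>_. Z)) samples {..<S}"
proof -
  let ?K = "\<lambda>s. {Suc s} \<times> {..<T}"
  have "indep_vars (\<lambda>s. PiM (?K s) (\<lambda>_. Z)) (\<lambda>s \<omega>. restrict (\<lambda>i. (case i of (s, t) \<Rightarrow> \<xi> s t) \<omega>) (?K s)) {..<S}"
    by (intro indep_vars_restrict[OF indep]) (auto simp: disjoint_family_on_def)
  then have "indep_vars (\<lambda>_. PiM {..<T} (\<lambda>_. Z))
      (\<lambda>s \<omega>. restrict (\<lambda>t. restrict (\<lambda>i. (case i of (s, t) \<Rightarrow> \<xi> s t) \<omega>) (?K s) (Suc s, t)) {..<T}) {..<S}"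
    by (rule indep_vars_compose2[where Y = "\<lambda>s r. restrict (\<lambda>t. r (Suc s, t)) {..<T}"])
      (intro measurable_restrict measurable_component_singleton; simp)
  moreover have "restrict (\<lambda>t. restrict (\<lambda>i. (case i of (s, t) \<Rightarrow> \<xi> s t) \<omega>) (?K s) (Suc s, t)) {..<T} = samples s \<omega>" for s \<omega>
    by (auto simp: samples_def restrict_def)
  ultimately show ?thesis by simp
qed

lemma T_conditions:
  assumes "s < S"
  shows "320 * M\<^sup>2 * (R s)\<^sup>2 / (e s)\<^sup>2 \<le> real T"
    "320 * B\<^sup>2 * (L * G powr v * R s powr v)\<^sup>2 / (e s)\<^sup>2 \<le> real T"
    "8192 * ln (1 / dt) * M\<^sup>2 * (R s)\<^sup>2 / (e s)\<^sup>2 \<le> real T"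
    "8192 * ln (1 / dt) * B\<^sup>2 * (L * G powr v * R s powr v)\<^sup>2 / (e s)\<^sup>2 \<le> real T"
  using T[of "Suc s"] assms unfolding stage_requirement_le_iff R_def e_def dt_def by auto

lemma T_pos: "0 < T"
proof -
  have "0 < 320 * M\<^sup>2 * (R 0)\<^sup>2 / (e 0)\<^sup>2" using MB R_pos[of 0] e_pos[of 0] by simp
  then show ?thesis using T_conditions(1)[of 0] S_pos by linarith
qed

lemma stage_measurable:
  "(\<lambda>(x, z). stage s x z) \<in> measurable (restrict_space borel X \<Otimes>\<^sub>M PiM {..<T} (\<lambda>_. Z)) (restrict_space borel X)"
  unfolding stage_def case_prod_beta'
proof (rule stage_average_measurable)
  show "(\<lambda>q. snd q i) \<in> measurable (restrict_space borel X \<Otimes>\<^sub>M PiM {..<T} (\<lambda>_. Z)) Z" if "i < T" for i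
    using measurable_compose[OF measurable_snd measurable_component_singleton[of i "{..<T}" "\<lambda>_. Z"]] that by simp
qed (use R_pos[of s] L_pos T_pos in auto)

lemma samples_measurable: "s < S \<Longrightarrow> samples s \<in> measurable \<Omega> (PiM {..<T} (\<lambda>_. Z))"
  using indep_samples by (auto simp: indep_vars_def)

lemma stage_at_measurable:
  assumes "s < S" "x \<in> X"
  shows "(\<lambda>\<omega>. stage s x (samples s \<omega>)) \<in> measurable \<Omega> (restrict_space borel X)"
proof -
  have "x \<in> space (restrict_space borel X)" using assms by (simp add: space_restrict_space)
  from measurable_compose[OF samples_measurable[OF assms(1)] measurable_compose[OF measurable_Pair1'[OF this] stage_measurable]]
  show ?thesis by simp
qed

text \<open>The summand \<open>eps\<close> is the level of the comparison point, which no stage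
  improves; only \<open>e s\<close> is halved. At \<open>s = S\<close> both summands are at most
  \<open>eps\<close>.\<close>

definition bad where "bad s = {x\<in>X. e s + eps < P x - Pmin}"

lemma bad_measurable: "bad s \<in> sets (restrict_space borel X)"
proof -
  have "{x \<in> space (restrict_space borel X). e s + eps + Pmin < P x} \<in> sets (restrict_space borel X)"
    using primal_measurable by measurable
  moreover have "{x \<in> space (restrict_space borel X). e s + eps + Pmin < P x} = bad s"
    by (auto simp: bad_def space_restrict_space)
  ultimately show ?thesis by simp
qed

text \<open>A start point that is not bad has a comparison point of gap at most \<open>eps\<close>
  inside the primal ball. Success of the stage leaves a gap of at most \<open>eps + e s / 2\<close>,
  which is the threshold of \<open>bad (Suc s)\<close>.\<close>

lemma prob_bad_Suc:
  assumes s: "s < S" and x: "x \<in> X" "x \<notin> bad s"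
  shows "prob {\<omega>\<in>space \<Omega>. stage s x (samples s \<omega>) \<in> bad (Suc s)} \<le> dt"
proof -
  have gap: "P x - Pmin \<le> e s + eps" using x by (simp add: bad_def)
  obtain xd where xd: "xd \<in> X" "P xd - Pmin \<le> eps" "norm (x - xd) \<le> c * e s / eps powr (1 - \<theta>)"
    using near_sublevel_point[OF eps(1) less_imp_le[OF e_pos] error_bound x(1) gap] by blast
  \<comment> \<open>The distance bound is linear in \<open>e s\<close>, so it is halved together
    with the radius, and the condition on \<open>Rx1\<close> carries over to all stages.\<close>
  have "c * e s / eps powr (1 - \<theta>) = (c * eps0 / eps powr (1 - \<theta>)) / 2 ^ s" by (simp add: e_def)
  also have "\<dots> \<le> R s" unfolding R_def using Rx1 by (intro divide_right_mono) auto
  finally have near: "norm (x - xd) \<le> R s" using xd by linarith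
  have s': "Suc s \<in> {1..S}" using s by simp
  interpret stage: rspd_stage Y phis phi p lam v L X l g G \<Omega> Z gx gy M B "\<xi> (Suc s)" T x xd "R s" "e s" dt
    using indep_stage[OF s'] unbiased_x[OF s'] unbiased_y[OF s'] x(1) xd(1) near R_pos e_pos dt_bounds T_conditions[OF s]
    by unfold_locales auto
  have eq: "stage.xbar \<omega> = stage s x (samples s \<omega>)" for \<omega>
  proof -
    have "stage.xbar \<omega> = stage s x (\<lambda>t. \<xi> (Suc s) t \<omega>)"
      unfolding stage_def stage.xbar_def
      using stage.stage_iterates_eq[of \<omega>, unfolded stage.Ry_def stage.etax_def stage.etay_def] by simp
    also have "\<dots> = stage s x (samples s \<omega>)"
      unfolding stage_def by (intro arg_cong2[where f = scaleR] sum.cong refl arg_cong[where f = fst] stage_iterates_cong)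
        (auto simp: samples_def)
    finally show ?thesis .
  qed
  have "{\<omega>\<in>space \<Omega>. stage s x (samples s \<omega>) \<in> bad (Suc s)} \<subseteq> {\<omega>\<in>space \<Omega>. P xd + e s / 2 < P (stage s x (samples s \<omega>))}"
    using xd(2) by (auto simp: bad_def e_def)
  moreover have "{\<omega>\<in>space \<Omega>. P xd + e s / 2 < P (stage s x (samples s \<omega>))} \<in> events"
    using measurable_compose[OF stage_at_measurable[OF s x(1)] primal_measurable] by measurable
  ultimately have "prob {\<omega>\<in>space \<Omega>. stage s x (samples s \<omega>) \<in> bad (Suc s)}
      \<le> prob {\<omega>\<in>space \<Omega>. P xd + e s / 2 < P (stage s x (samples s \<omega>))}"
    by (rule finite_measure_mono)
  also have "\<dots> \<le> dt" using stage.stage_failure by (simp add: eq)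
  finally show ?thesis .
qed

text \<open>Current failure plus the failure budget of the remaining stages. From a good state the
  next failure is paid from the budget \<open>dt\<close>; from a bad state the indicator already
  contributes 1. The initial value is \<open>\<delta>\<close> and the final one is the failure
  indicator, so the drift inequality acts as a union bound.\<close>

definition potential :: "nat \<Rightarrow> 'a \<Rightarrow> ennreal" where
  "potential s x = indicator (bad s) x + ennreal (real (S - s) * dt)"

lemma potential_drift:
  assumes s: "s < S" and x: "x \<in> X"
  shows "(\<integral>\<^sup>+\<omega>. potential (Suc s) (stage s x (samples s \<omega>)) \<partial>\<Omega>) \<le> potential s x"
proof -
  let ?E = "{\<omega>\<in>space \<Omega>. stage s x (samples s \<omega>) \<in> bad (Suc s)}"
  have E: "?E \<in> events"
    using measurable_sets[OF stage_at_measurable[OF s x] bad_measurable[of "Suc s"]]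
    by (simp add: vimage_def Int_def conj_commute)
  have "(\<integral>\<^sup>+\<omega>. potential (Suc s) (stage s x (samples s \<omega>)) \<partial>\<Omega>)
      = (\<integral>\<^sup>+\<omega>. indicator ?E \<omega> + ennreal (real (S - Suc s) * dt) \<partial>\<Omega>)"
    by (intro nn_integral_cong) (auto simp: potential_def indicator_def)
  also have "\<dots> = ennreal (prob ?E) + ennreal (real (S - Suc s) * dt)"
    using E by (subst nn_integral_add) (auto simp: emeasure_eq_measure prob_space)
  also have "\<dots> = ennreal (prob ?E + real (S - Suc s) * dt)"
    using dt_bounds by (intro ennreal_plus[symmetric]) auto
  also have "\<dots> \<le> potential s x"
  proof (cases "x \<in> bad s")
    case True
    have "prob ?E + real (S - Suc s) * dt \<le> 1 + real (S - s) * dt"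
      using dt_bounds by (intro add_mono mult_right_mono prob_le_1) auto
    then have "ennreal (prob ?E + real (S - Suc s) * dt) \<le> ennreal (1 + real (S - s) * dt)"
      by (rule ennreal_leI)
    also have "\<dots> = potential s x" using True dt_bounds by (simp add: potential_def)
    finally show ?thesis .
  next
    case False
    have *: "real (S - s) = 1 + real (S - Suc s)" using s by simp
    have "prob ?E + real (S - Suc s) * dt \<le> real (S - s) * dt"
      using prob_bad_Suc[OF s x False] unfolding * distrib_right by simp
    then show ?thesis using False by (simp add: potential_def ennreal_leI)
  qed
  finally show ?thesis .
qed

lemma xs_measurable: "s \<le> S \<Longrightarrow> xs s \<in> measurable \<Omega> (restrict_space borel X)"
  by (rule chain_measurable[where F = stage and Z = "PiM {..<T} (\<lambda>_. Z)" and zeta = samples and n = S and ?w0.0 = x0])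
    (use indep_samples x0 xs_0 xs_Suc stage_measurable in \<open>auto simp: space_restrict_space\<close>)

lemma prob_bad_final: "prob {\<omega>\<in>space \<Omega>. xs S \<omega> \<in> bad S} \<le> \<delta>"
proof -
  let ?E = "{\<omega>\<in>space \<Omega>. xs S \<omega> \<in> bad S}"
  have E: "?E \<in> events"
    using measurable_sets[OF xs_measurable[of S] bad_measurable[of S]]
    by (simp add: vimage_def Int_def conj_commute)
  have "(\<integral>\<^sup>+\<omega>. potential S (xs S \<omega>) \<partial>\<Omega>) \<le> potential 0 x0"
  proof (rule chain_nn_integral_le[where F = stage and Z = "PiM {..<T} (\<lambda>_. Z)" and zeta = samples and n = S
        and N = "restrict_space borel X"])
    show "potential k \<in> borel_measurable (restrict_space borel X)" for k
      unfolding potential_def using bad_measurable by measurable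
  qed (use indep_samples x0 xs_0 xs_Suc stage_measurable potential_drift in \<open>auto simp: space_restrict_space\<close>)
  also have "potential 0 x0 = ennreal \<delta>"
    using x0 eps dt_bounds by (simp add: potential_def bad_def e_def)
  also have "(\<integral>\<^sup>+\<omega>. potential S (xs S \<omega>) \<partial>\<Omega>) = (\<integral>\<^sup>+\<omega>. indicator ?E \<omega> \<partial>\<Omega>)"
    by (intro nn_integral_cong) (auto simp: potential_def indicator_def)
  also have "\<dots> = ennreal (prob ?E)" using E by (simp add: emeasure_eq_measure)
  finally show ?thesis using \<delta> by simp
qed

theorem rspd_success:
  "1 - \<delta> \<le> \<P>(\<omega> in \<Omega>. P (rspd X Y gx gy A M B L G v x0 S T Rx1 eps0 (\<lambda>s t. \<xi> s t \<omega>)) - Pmin \<le> 2 * eps)"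
proof -
  let ?E = "{\<omega>\<in>space \<Omega>. xs S \<omega> \<in> bad S}"
  let ?D = "{\<omega>\<in>space \<Omega>. P (xs S \<omega>) - Pmin \<le> 2 * eps}"
  have E: "?E \<in> events"
    using measurable_sets[OF xs_measurable[of S] bad_measurable[of S]]
    by (simp add: vimage_def Int_def conj_commute)
  have "(\<lambda>\<omega>. P (xs S \<omega>)) \<in> borel_measurable \<Omega>"
    using measurable_compose[OF xs_measurable primal_measurable] by simp
  then have D: "?D \<in> events" by measurable
  have "e S \<le> eps" using num_stages_bounds(2)[OF eps] S by (simp add: e_def)
  moreover have "xs S \<omega> \<in> X" if "\<omega> \<in> space \<Omega>" for \<omega>
    using measurable_space[OF xs_measurable that] by (simp add: space_restrict_space)
  ultimately have "space \<Omega> - ?E \<subseteq> ?D"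
    by (auto simp: bad_def)
  then have "prob (space \<Omega> - ?E) \<le> prob ?D" using D by (intro finite_measure_mono)
  then have "1 - \<delta> \<le> prob ?D" using prob_compl[OF E] prob_bad_final by linarith
  then show ?thesis by (simp add: rspd_def xs_def)
qed

end

subsection \<open>Iteration complexity\<close>

text \<open>The radius is at most \<open>e * w\<close> with \<open>w\<close> of order
  \<open>u powr (1 - \<theta>)\<close>. The dual requirement fixes the rate: it is of order
  \<open>w powr (2 * v) * e powr (2 * v - 2)\<close>, and \<open>e\<close> can be as small as
  \<open>eps\<close>. The primal one is of order \<open>w\<^sup>2\<close> and is dominated because
  \<open>v \<le> 1\<close>. The constant 8512 is 320 + 8192.\<close>

lemma stage_requirement_le_rate:
  assumes v: "0 \<le> v" "v \<le> 1" and \<theta>: "0 \<le> \<theta>" and c: "0 < c" and k: "0 < k" and L: "0 \<le> L"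
    and eps: "0 < eps" "eps < eps0" "eps \<le> eps0 / 2 ^ s"
    and R: "0 < Rx1" "Rx1 \<le> k * (c * eps0 / eps powr (1 - \<theta>))"
    and ln: "0 \<le> ln (1 / dt)"
  defines "E \<equiv> (1 / eps) powr (2 * (1 - v * \<theta>))"
  shows "stage_requirement M B L G v eps0 Rx1 dt (Suc s)
    \<le> 8512 * (M\<^sup>2 * ((k * c)\<^sup>2 * eps0 powr (2 * \<theta> * (1 - v)))
        + B\<^sup>2 * ((L * G powr v)\<^sup>2 * (k * c) powr (2 * v))) * (E * (1 + ln (1 / dt)))"
proof -
  define u where "u = 1 / eps"
  define e where "e = eps0 / 2 ^ s"
  define r where "r = Rx1 / 2 ^ s"
  define w where "w = k * c * u powr (1 - \<theta>)"
  have u: "0 < u" and e: "0 < e" and r: "0 < r" and w: "0 < w"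
    using eps R c k by (auto simp: u_def e_def r_def w_def)
  have "Rx1 \<le> eps0 * w"
    using R(2) eps by (simp add: w_def u_def powr_divide algebra_simps)
  then have rw: "r \<le> e * w"
    by (simp add: r_def e_def divide_right_mono)
  have sq: "(a powr b)\<^sup>2 = a powr (2 * b)" for a b :: real
    by (simp add: power2_eq_square powr_add[symmetric])
  define Q1 where "Q1 = (k * c)\<^sup>2 * eps0 powr (2 * \<theta> * (1 - v))"
  define Q2 where "Q2 = (L * G powr v)\<^sup>2 * (k * c) powr (2 * v)"
  have Q: "0 \<le> Q1" "0 \<le> Q2" by (auto simp: Q1_def Q2_def)
  have E: "0 \<le> E" by (simp add: E_def)
  have x: "r\<^sup>2 / e\<^sup>2 \<le> Q1 * E"
  proof -
    have "r\<^sup>2 / e\<^sup>2 \<le> w\<^sup>2"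
      using power_mono[OF rw, of 2] r e by (simp add: pos_divide_le_eq power_mult_distrib mult.commute)
    also have "\<dots> = (k * c)\<^sup>2 * u powr (2 * (1 - \<theta>))"
      by (simp only: w_def power_mult_distrib sq)
    \<comment> \<open>The primal power is smaller than \<open>E\<close> by a nonnegative power of
      \<open>eps\<close>, which is then bounded by the same power of \<open>eps0\<close>.\<close>
    also have "u powr (2 * (1 - \<theta>)) = eps powr (2 * \<theta> * (1 - v)) * E"
    proof -
      have "eps powr (2 * \<theta> * (1 - v)) = u powr (- (2 * \<theta> * (1 - v)))"
        using eps by (simp add: u_def powr_minus powr_divide)
      then show ?thesis
        unfolding E_def u_def[symmetric] by (simp add: powr_add[symmetric] algebra_simps)
    qed
    also have "(k * c)\<^sup>2 * (eps powr (2 * \<theta> * (1 - v)) * E) \<le> (k * c)\<^sup>2 * (eps0 powr (2 * \<theta> * (1 - v)) * E)"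
      using eps v \<theta> E by (intro mult_left_mono mult_right_mono powr_mono2) auto
    finally show ?thesis by (simp add: Q1_def mult.assoc)
  qed
  have y: "(L * G powr v * r powr v)\<^sup>2 / e\<^sup>2 \<le> Q2 * E"
  proof -
    have "r powr v \<le> (e * w) powr v" using rw r v by (intro powr_mono2) auto
    then have "(r powr v)\<^sup>2 \<le> ((e * w) powr v)\<^sup>2" by (intro power_mono) auto
    also have "\<dots> = e powr (2 * v) * w powr (2 * v)" using e w by (simp add: powr_mult power_mult_distrib sq)
    finally have "(r powr v)\<^sup>2 / e\<^sup>2 \<le> e powr (2 * v) * w powr (2 * v) / e\<^sup>2"
      by (intro divide_right_mono) auto
    also have "\<dots> = w powr (2 * v) * e powr (2 * v - 2)"
      using e by (simp add: powr_diff)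
    \<comment> \<open>The exponent \<open>2 * v - 2\<close> is not positive, so the bound at the
      smallest admissible level \<open>eps\<close> covers every stage.\<close>
    also have "\<dots> \<le> w powr (2 * v) * eps powr (2 * v - 2)"
      using eps v by (intro mult_left_mono powr_mono2') (auto simp: e_def)
    also have "\<dots> = (k * c) powr (2 * v) * E"
    proof -
      have "w powr (2 * v) = (k * c) powr (2 * v) * u powr ((1 - \<theta>) * (2 * v))"
        using c k u by (simp add: w_def powr_mult powr_powr)
      moreover have "eps powr (2 * v - 2) = u powr (2 - 2 * v)"
        using eps by (simp add: u_def powr_divide powr_diff)
      ultimately show ?thesis
        unfolding E_def u_def[symmetric] by (simp add: powr_add[symmetric] algebra_simps)
    qed
    finally have "(L * G powr v)\<^sup>2 * ((r powr v)\<^sup>2 / e\<^sup>2) \<le> (L * G powr v)\<^sup>2 * ((k * c) powr (2 * v) * E)"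
      by (intro mult_left_mono) auto
    then show ?thesis by (simp add: Q2_def power_mult_distrib mult.assoc)
  qed
  have scale: "n * a * z \<le> 8512 * (a * q1 + b * q2) * (E * (1 + ln (1 / dt)))"
    if "z \<le> q1 * E" "0 \<le> a" "0 \<le> b" "0 \<le> q1" "0 \<le> q2" "0 \<le> n" "n \<le> 8512 * (1 + ln (1 / dt))" for n a b z q1 q2
  proof -
    have "n * (a * z) \<le> n * (a * (q1 * E) + b * (q2 * E))"
      using that E by (intro mult_left_mono add_increasing2 mult_left_mono) auto
    also have "\<dots> \<le> 8512 * (1 + ln (1 / dt)) * (a * (q1 * E) + b * (q2 * E))"
      using that E by (intro mult_right_mono) auto
    finally show ?thesis by (simp add: algebra_simps)
  qed
  have n: "320 \<le> 8512 * (1 + ln (1 / dt))" "8192 * ln (1 / dt) \<le> 8512 * (1 + ln (1 / dt))"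
    using ln by simp_all
  have t1: "n * M\<^sup>2 * (r\<^sup>2 / e\<^sup>2) \<le> 8512 * (M\<^sup>2 * Q1 + B\<^sup>2 * Q2) * (E * (1 + ln (1 / dt)))"
    if "0 \<le> n" "n \<le> 8512 * (1 + ln (1 / dt))" for n
    using Q that by (intro scale x) auto
  have t2: "n * B\<^sup>2 * ((L * G powr v * r powr v)\<^sup>2 / e\<^sup>2) \<le> 8512 * (M\<^sup>2 * Q1 + B\<^sup>2 * Q2) * (E * (1 + ln (1 / dt)))"
    if "0 \<le> n" "n \<le> 8512 * (1 + ln (1 / dt))" for n
    unfolding add.commute[of "M\<^sup>2 * Q1"] using Q that by (intro scale y) auto
  show ?thesis
    unfolding stage_requirement_le_iff r_def[symmetric] e_def[symmetric] Q1_def[symmetric] Q2_def[symmetric]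
    using t1[of 320] t2[of 320] t1[of "8192 * ln (1 / dt)"] t2[of "8192 * ln (1 / dt)"] n ln
    by (simp only: times_divide_eq_right mult_nonneg_nonneg zero_le_numeral simp_thms)
qed

lemma num_stages_le_log:
  assumes "0 < eps" "eps < eps0"
  shows "real (num_stages eps0 eps) \<le> (1 + (\<bar>ln eps0\<bar> + 1) / ln 2) * (1 + \<bar>ln (1 / eps)\<bar>)"
proof -
  have "log 2 (eps0 / eps) = (ln eps0 + ln (1 / eps)) / ln 2"
    using assms by (simp add: log_def ln_div)
  also have "\<dots> \<le> (\<bar>ln eps0\<bar> + \<bar>ln (1 / eps)\<bar>) / ln 2"
    by (intro divide_right_mono) auto
  finally have "real (num_stages eps0 eps) \<le> 1 + (\<bar>ln eps0\<bar> + \<bar>ln (1 / eps)\<bar>) / ln 2"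
    using num_stages_bounds(4)[OF assms] by linarith
  also have "\<dots> \<le> 1 + (\<bar>ln eps0\<bar> + 1) * (1 + \<bar>ln (1 / eps)\<bar>) / ln 2"
    by (intro add_left_mono divide_right_mono) (auto simp: algebra_simps)
  also have "\<dots> \<le> (1 + (\<bar>ln eps0\<bar> + 1) / ln 2) * (1 + \<bar>ln (1 / eps)\<bar>)"
    by (simp add: algebra_simps)
  finally show ?thesis .
qed

text \<open>\<open>K1\<close> and \<open>K2\<close> are the constants hidden in the orders of the
  first radius and of the stage length. \<open>C\<close> is chosen before accuracy, confidence,
  radius and stage length, which gives the suppressed dependence its meaning. One logarithm bounds
  the number of stages, the other is that of the confidence per stage.\<close>

lemma rspd_complexity:
  fixes M B L G v c \<theta> eps0 K1 K2 :: real
  assumes v: "0 \<le> v" "v \<le> 1" and \<theta>: "0 \<le> \<theta>" and c: "0 < c" and L: "0 \<le> L"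
  shows "\<exists>C>0. \<forall>eps' \<delta>' Rx1' S' T'.
     0 < eps' \<and> eps' < eps0 \<and> 0 < \<delta>' \<and> \<delta>' < 1 \<and> S' = num_stages eps0 eps' \<and>
     c * eps0 / eps' powr (1 - \<theta>) \<le> Rx1' \<and> Rx1' \<le> K1 * (c * eps0 / eps' powr (1 - \<theta>)) \<and>
     real T' \<le> K2 * Max (stage_requirement M B L G v eps0 Rx1' (\<delta>' / real S') ` {1..S'})
     \<longrightarrow> real (S' * T') \<le>
           C * (1 / eps') powr (2 * (1 - v * \<theta>)) * (1 + \<bar>ln (1 / eps')\<bar>) * (1 + ln (real S' / \<delta>'))"
proof -
  \<comment> \<open>\<open>K1\<close> and \<open>K2\<close> may be any reals; absolute values plus 1
    make them positive, just as \<open>Q + 1\<close> keeps \<open>C\<close> positive.\<close>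
  define k where "k = \<bar>K1\<bar> + 1"
  define H where "H = 1 + (\<bar>ln eps0\<bar> + 1) / ln 2"
  define Q where "Q = 8512 * (M\<^sup>2 * ((k * c)\<^sup>2 * eps0 powr (2 * \<theta> * (1 - v)))
      + B\<^sup>2 * ((L * G powr v)\<^sup>2 * (k * c) powr (2 * v)))"
  define C where "C = H * ((\<bar>K2\<bar> + 1) * (Q + 1))"
  have k: "0 < k" by (simp add: k_def)
  have H: "0 < H" by (simp add: H_def add_pos_pos)
  have Q: "0 \<le> Q" by (simp add: Q_def)
  have "0 < C" using H Q by (simp add: C_def)
  moreover have "real (S * T) \<le> C * (1 / eps) powr (2 * (1 - v * \<theta>)) * (1 + \<bar>ln (1 / eps)\<bar>) * (1 + ln (real S / \<delta>))"
    if eps: "0 < eps" "eps < eps0" and \<delta>: "0 < \<delta>" "\<delta> < 1" and S: "S = num_stages eps0 eps"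
      and R: "c * eps0 / eps powr (1 - \<theta>) \<le> Rx1" "Rx1 \<le> K1 * (c * eps0 / eps powr (1 - \<theta>))"
      and T: "real T \<le> K2 * Max (stage_requirement M B L G v eps0 Rx1 (\<delta> / real S) ` {1..S})"
    for eps \<delta> Rx1 S T
  proof -
    let ?E = "(1 / eps) powr (2 * (1 - v * \<theta>))" and ?l = "ln (real S / \<delta>)"
    have S1: "1 \<le> S" using num_stages_bounds(1)[OF eps] S by simp
    have pos: "0 < c * eps0 / eps powr (1 - \<theta>)" using c eps by simp
    have R0: "0 < Rx1" using pos R by linarith
    have "K1 * (c * eps0 / eps powr (1 - \<theta>)) \<le> k * (c * eps0 / eps powr (1 - \<theta>))"
      using pos by (intro mult_right_mono) (auto simp: k_def)
    then have Rk: "Rx1 \<le> k * (c * eps0 / eps powr (1 - \<theta>))" using R by linarith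
    have "1 \<le> real S / \<delta>" using S1 \<delta> by (simp add: le_divide_eq)
    then have l0: "0 \<le> ?l" by simp
    have ln_eq: "ln (1 / (\<delta> / real S)) = ?l" by simp
    have each: "stage_requirement M B L G v eps0 Rx1 (\<delta> / real S) s \<le> Q * (?E * (1 + ?l))" if s: "s \<in> {1..S}" for s
    proof -
      obtain j where j: "s = Suc j" using s by (cases s) auto
      have "eps \<le> eps0 / 2 ^ (S - 1)" using num_stages_bounds(3)[OF eps] S by simp
      also have "\<dots> \<le> eps0 / 2 ^ j"
        using s j eps by (intro divide_left_mono power_increasing) auto
      finally have "eps \<le> eps0 / 2 ^ j" .
      then show ?thesis
        unfolding j Q_def
        using stage_requirement_le_rate[of v \<theta> c k L eps eps0 j Rx1 "\<delta> / real S" M B G] v \<theta> c k L eps R0 Rk l0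
        unfolding ln_eq by blast
    qed
    let ?A = "stage_requirement M B L G v eps0 Rx1 (\<delta> / real S) ` {1..S}"
    have A: "finite ?A" "?A \<noteq> {}" using S1 by auto
    have M_le: "Max ?A \<le> Q * (?E * (1 + ?l))" using each A by (subst Max_le_iff) auto
    \<comment> \<open>A nonnegative maximum is what allows \<open>K2\<close> to be replaced by its
      absolute value plus 1.\<close>
    have "0 \<le> stage_requirement M B L G v eps0 Rx1 (\<delta> / real S) 1"
    proof -
      have "0 \<le> 320 * M\<^sup>2 * (Rx1 / 2 ^ 0)\<^sup>2 / (eps0 / 2 ^ 0)\<^sup>2" by simp
      also have "\<dots> \<le> stage_requirement M B L G v eps0 Rx1 (\<delta> / real S) (Suc 0)"
        using stage_requirement_le_iff[THEN iffD1, OF order_refl] by blast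
      finally show ?thesis by simp
    qed
    also have "\<dots> \<le> Max ?A" using A S1 by (intro Max_ge) auto
    finally have M0: "0 \<le> Max ?A" .
    have "real T \<le> K2 * Max ?A" by (rule T)
    also have "\<dots> \<le> (\<bar>K2\<bar> + 1) * Max ?A" using M0 by (intro mult_right_mono) auto
    also have "\<dots> \<le> (\<bar>K2\<bar> + 1) * (Q * (?E * (1 + ?l)))" using M_le by (intro mult_left_mono) auto
    also have "\<dots> \<le> (\<bar>K2\<bar> + 1) * ((Q + 1) * (?E * (1 + ?l)))"
      using l0 by (intro mult_left_mono mult_right_mono) auto
    finally have T': "real T \<le> (\<bar>K2\<bar> + 1) * ((Q + 1) * (?E * (1 + ?l)))" .
    have "real (S * T) = real S * real T" by simp
    also have "\<dots> \<le> (H * (1 + \<bar>ln (1 / eps)\<bar>)) * ((\<bar>K2\<bar> + 1) * ((Q + 1) * (?E * (1 + ?l))))"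
      using num_stages_le_log[OF eps] T' H unfolding S[symmetric] H_def[symmetric]
      by (intro mult_mono) auto
    also have "\<dots> = C * ?E * (1 + \<bar>ln (1 / eps)\<bar>) * (1 + ?l)"
      by (simp only: C_def mult_ac)
    finally show ?thesis .
  qed
  ultimately show ?thesis by blast
qed

theorem theorem3:
  fixes X :: "(real^'d) set" and Y :: "(real^'n) set"
    and l :: "real^'d \<Rightarrow> real^'n" and g :: "real^'d \<Rightarrow> real"
    and phi phis :: "real^'n \<Rightarrow> real"
    and gx :: "real^'d \<Rightarrow> real^'n \<Rightarrow> 'z \<Rightarrow> real^'d"
    and gy :: "real^'d \<Rightarrow> real^'n \<Rightarrow> 'z \<Rightarrow> real^'n"
    and Z :: "'z measure" and \<Omega> :: "'w measure" and \<xi> :: "nat \<Rightarrow> nat \<Rightarrow> 'w \<Rightarrow> 'z"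
    and M B G L v p lam c \<theta> eps0 eps \<delta> Rx1 :: real and S T :: nat and x0 :: "real^'d"
  defines "f \<equiv> saddle_obj l phis g"
    and "P \<equiv> primal_obj l phi g"
  assumes X: "closed X" "convex X"
    and l: "\<And>i. convex_on X (\<lambda>x. l x $ i)" "\<And>i. lsc_on X (\<lambda>x. l x $ i)"
    and g: "convex_on X g" "lsc_on X g"
    and Y: "closed Y" "convex_on Y phis"
    and conj: "convex_conjugate (extend_infty Y phis) = (\<lambda>u. ereal (phi u))"
      "convex_conjugate (\<lambda>u. ereal (phi u)) = extend_infty Y phis"
    and sign: "(\<exists>A b. \<forall>x\<in>X. l x = A *v x + b) \<or> (\<forall>y\<in>Y. \<forall>i. 0 \<le> y $ i)"
    and min: "minimizers X P \<noteq> {}"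
    and prob: "prob_space \<Omega>"
    and indep: "prob_space.indep_vars \<Omega> (\<lambda>_. Z) (\<lambda>(s, t). \<xi> s t) ({1..S} \<times> {..<T})"
    and meas: "(\<lambda>((x, y), z). gx x y z) \<in> borel_measurable (restrict_space borel (X \<times> Y) \<Otimes>\<^sub>M Z)"
      "(\<lambda>((x, y), z). gy x y z) \<in> borel_measurable (restrict_space borel (X \<times> Y) \<Otimes>\<^sub>M Z)"
    and unbiased_x: "\<And>s t x y. s \<in> {1..S} \<Longrightarrow> t < T \<Longrightarrow> x \<in> X \<Longrightarrow> y \<in> Y \<Longrightarrow>
      subgradient_on X (\<lambda>x'. f x' y) x (prob_space.expectation \<Omega> (\<lambda>\<omega>. gx x y (\<xi> s t \<omega>)))"
    and unbiased_y: "\<And>s t x y. s \<in> {1..S} \<Longrightarrow> t < T \<Longrightarrow> x \<in> X \<Longrightarrow> y \<in> Y \<Longrightarrow>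
      supergradient_on Y (\<lambda>y'. f x y') y (prob_space.expectation \<Omega> (\<lambda>\<omega>. gy x y (\<xi> s t \<omega>)))"
    and eps: "0 < eps" "eps < eps0"
    and x0: "x0 \<in> X" "P x0 - min_value X P \<le> eps0"
    and MB: "0 < M" "0 < B"
    and bound_x: "\<And>x y z. x \<in> X \<Longrightarrow> y \<in> Y \<Longrightarrow> z \<in> space Z \<Longrightarrow> norm (gx x y z) \<le> M"
    and bound_y: "\<And>x y z. x \<in> X \<Longrightarrow> y \<in> Y \<Longrightarrow> z \<in> space Z \<Longrightarrow> norm (gy x y z) \<le> B"
    and unif: "2 \<le> p" "0 < lam" "uniformly_convex_on Y p lam phis"
    and v: "v = 1 / (p - 1)" and L: "L = (1 / lam) powr v"
    and lip: "G-lipschitz_on X l"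
    and error_bound: "0 < c" "0 < \<theta>" "\<theta> \<le> 1"
      "\<And>x. x \<in> opt_sublevel X P eps \<Longrightarrow>
         infdist x (minimizers X P) \<le> c * (P x - min_value X P) powr \<theta>"
    and \<delta>: "0 < \<delta>" "\<delta> < 1"
    and S: "S = num_stages eps0 eps"
    and Rx1: "c * eps0 / eps powr (1 - \<theta>) \<le> Rx1"
    and T: "\<And>s. s \<in> {1..S} \<Longrightarrow> stage_requirement M B L G v eps0 Rx1 (\<delta> / real S) s \<le> real T"
  shows "holder_gradient L v phi
    \<and> \<P>(\<omega> in \<Omega>. P (rspd X Y gx gy (dual_map l phis Y) M B L G v x0 S T Rx1 eps0
                          (\<lambda>s t. \<xi> s t \<omega>))
                      - min_value X P \<le> 2 * eps) \<ge> 1 - \<delta>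
    \<and> (\<forall>K1 K2. \<exists>C>0. \<forall>eps' \<delta>' Rx1' S' T'.
           0 < eps' \<and> eps' < eps0 \<and> 0 < \<delta>' \<and> \<delta>' < 1 \<and> S' = num_stages eps0 eps' \<and>
           c * eps0 / eps' powr (1 - \<theta>) \<le> Rx1' \<and> Rx1' \<le> K1 * (c * eps0 / eps' powr (1 - \<theta>)) \<and>
           real T' \<le> K2 * Max (stage_requirement M B L G v eps0 Rx1' (\<delta>' / real S') ` {1..S'})
           \<longrightarrow> real (S' * T') \<le>
                 C * (1 / eps') powr (2 * (1 - v * \<theta>))
                   * (1 + \<bar>ln (1 / eps')\<bar>) * (1 + ln (real S' / \<delta>')))"
proof -
  interpret prob_space \<Omega> by (rule prob)
  interpret conjugate_pair Y phis phi p lam v L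
    by unfold_locales (use conj unif v L in auto)
  have S1: "1 \<in> {1..S}" using num_stages_bounds(1)[OF eps] S by simp
  \<comment> \<open>This guarantees that a first sample of stage 1 exists, so that
    \<open>unbiased_x\<close> can be invoked. With \<open>T\<close> zero, the requirement of stage 1
    would force a positive quantity to be at most 0.\<close>
  have T0: "0 < T"
  proof (rule ccontr)
    assume "\<not> 0 < T"
    then have "320 * M\<^sup>2 * (Rx1 / 2 ^ 0)\<^sup>2 / (eps0 / 2 ^ 0)\<^sup>2 \<le> 0"
      using T[OF S1] stage_requirement_le_iff[of M B L G v eps0 Rx1 "\<delta> / real S" 0 0] by simp
    moreover have "0 < c * eps0 / eps powr (1 - \<theta>)" using error_bound eps by simp
    then have "0 < 320 * M\<^sup>2 * (Rx1 / 2 ^ 0)\<^sup>2 / (eps0 / 2 ^ 0)\<^sup>2" using Rx1 MB eps by simp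
    ultimately show False by linarith
  qed
  interpret saddle_problem Y phis phi p lam v L X l g G
  proof
    \<comment> \<open>The mean oracle at a single sample already is a subgradient at any given
      point.\<close>
    show "\<exists>d. subgradient_on X (\<lambda>x'. saddle_obj l phis g x' y) x d" if "x \<in> X" "y \<in> Y" for x y
      using unbiased_x[OF S1 T0 that] unfolding f_def by blast
    show "minimizers X (primal_obj l phi g) \<noteq> {}" using min by (simp add: P_def)
  qed (use X lip in auto)
  interpret rspd_run Y phis phi p lam v L X l g G \<Omega> Z gx gy M B \<xi> S T x0 c \<theta> eps0 eps \<delta> Rx1
  proof unfold_locales
    show "convex Y" using Y(2) by (rule convex_on_imp_convex)
    show "subgradient_on X (\<lambda>x'. saddle_obj l phis g x' y) x (expectation (\<lambda>\<omega>. gx x y (\<xi> s t \<omega>)))"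
      if "s \<in> {1..S}" "t < T" "x \<in> X" "y \<in> Y" for s t x y
      using unbiased_x[OF that] by (simp add: f_def)
    show "supergradient_on Y (saddle_obj l phis g x) y (expectation (\<lambda>\<omega>. gy x y (\<xi> s t \<omega>)))"
      if "s \<in> {1..S}" "t < T" "x \<in> X" "y \<in> Y" for s t x y
      using unbiased_y[OF that] by (simp add: f_def)
    show "primal_obj l phi g x0 - min_value X (primal_obj l phi g) \<le> eps0"
      using x0 by (simp add: P_def)
    show "infdist x (minimizers X (primal_obj l phi g))
        \<le> c * (primal_obj l phi g x - min_value X (primal_obj l phi g)) powr \<theta>"
      if "x \<in> opt_sublevel X (primal_obj l phi g) eps" for x
      using error_bound(4) that by (simp add: P_def)
  qed (fact Y meas MB bound_x bound_y indep eps x0 error_bound \<delta> S Rx1 T)+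
  show ?thesis
    using phi_holder_gradient rspd_success
      rspd_complexity[of v \<theta> c L eps0 _ _ M B G] v_pos v_le_1 error_bound L_pos
    unfolding P_def by (intro conjI allI) auto
qed

end
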